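(* Let $X$ be a Euclidean building of type $\widetilde A_n$ (viewed as a simplicial complex). Then the $1$-skeleton of $X$ is a weakly modular graph.
   Context: A simplicial graph $\Gamma$ is endowed with the path metric $d$ in which every edge has length $1$. $\Gamma$ is weakly modular if for every vertex $x$ of $\Gamma$ and every integer $n\geq 2$ the following hold. (Triangle condition) For any two adjacent vertices $x_1,x_2$ with $d(x,x_1)=d(x,x_2)=n$, there is a vertex $y$ with $d(y,x)=n-1$ and $d(y,x_1)=d(y,x_2)=1$. (Quadrangle condition) For any two vertices $x_1,x_2$ with $d(x,x_1)=d(x,x_2)=n$ and $d(x_1,x_2)=2$ such that $x_1,x_2$ are both adjacent to a common vertex at distance $n+1$ from $x$, there is a vertex $y$ with $d(y,x)=n-1$ and $d(y,x_1)=d(y,x_2)=1$. A Euclidean building of type $\widetilde A_n$ is a building, viewed as a simplicial complex, whose apartments are Coxeter complexes of the affine Coxeter group of type $\widetilde A_n$. *)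

theory Defs
  imports "HOL-Algebra.Generated_Groups" "HOL-Library.Extended_Nat"
begin

section \<open>Abstract simplicial complexes\<close>

text \<open>A complex is the set of its nonempty simplices; its vertex set is \<open>\<Union>K\<close>.\<close>

locale abstract_simplicial_complex =
  fixes K :: "'a set set"
  assumes finite_simplex: "\<sigma> \<in> K \<Longrightarrow> finite \<sigma>"
    and nonempty_simplex: "\<sigma> \<in> K \<Longrightarrow> \<sigma> \<noteq> {}"
    and face: "\<sigma> \<in> K \<Longrightarrow> \<tau> \<subseteq> \<sigma> \<Longrightarrow> \<tau> \<noteq> {} \<Longrightarrow> \<tau> \<in> K"

definition simplicial_iso :: "('a \<Rightarrow> 'b) \<Rightarrow> 'a set set \<Rightarrow> 'b set set \<Rightarrow> bool" where
  "simplicial_iso f K L \<longleftrightarrow> bij_betw f (\<Union>K) (\<Union>L) \<and> (\<lambda>\<sigma>. f ` \<sigma>) ` K = L"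

definition one_skeleton :: "'a set set \<Rightarrow> 'a set set" where
  "one_skeleton K = {\<sigma> \<in> K. card \<sigma> \<le> 2}"


section \<open>Weakly modular graphs\<close>

text \<open>A simplicial graph is a simplicial complex of dimension at most 1.\<close>

locale simplicial_graph = abstract_simplicial_complex \<Gamma>
  for \<Gamma> :: "'a set set" +
  assumes card_le_2: "\<sigma> \<in> \<Gamma> \<Longrightarrow> card \<sigma> \<le> 2"

definition adjacency :: "'a set set \<Rightarrow> ('a \<times> 'a) set" where
  "adjacency \<Gamma> = {(u, v). u \<noteq> v \<and> {u, v} \<in> \<Gamma>}"

text \<open>The path metric is the least length of an edge path, and is infinite between vertices of
  different connected components.\<close>

definition graph_dist :: "'a set set \<Rightarrow> 'a \<Rightarrow> 'a \<Rightarrow> enat" where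
  "graph_dist \<Gamma> u v = Inf (enat ` {k. (u, v) \<in> adjacency \<Gamma> ^^ k})"

definition triangle_condition :: "'a set set \<Rightarrow> bool" where
  "triangle_condition \<Gamma> \<longleftrightarrow>
    (\<forall>x\<in>\<Union>\<Gamma>. \<forall>n::nat. n \<ge> 2 \<longrightarrow>
      (\<forall>x\<^sub>1\<in>\<Union>\<Gamma>. \<forall>x\<^sub>2\<in>\<Union>\<Gamma>.
        (x\<^sub>1, x\<^sub>2) \<in> adjacency \<Gamma> \<and>
        graph_dist \<Gamma> x x\<^sub>1 = enat n \<and> graph_dist \<Gamma> x x\<^sub>2 = enat n \<longrightarrow>
        (\<exists>y\<in>\<Union>\<Gamma>. graph_dist \<Gamma> y x = enat (n - 1) \<and>
           graph_dist \<Gamma> y x\<^sub>1 = 1 \<and> graph_dist \<Gamma> y x\<^sub>2 = 1)))"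

definition quadrangle_condition :: "'a set set \<Rightarrow> bool" where
  "quadrangle_condition \<Gamma> \<longleftrightarrow>
    (\<forall>x\<in>\<Union>\<Gamma>. \<forall>n::nat. n \<ge> 2 \<longrightarrow>
      (\<forall>x\<^sub>1\<in>\<Union>\<Gamma>. \<forall>x\<^sub>2\<in>\<Union>\<Gamma>.
        graph_dist \<Gamma> x x\<^sub>1 = enat n \<and> graph_dist \<Gamma> x x\<^sub>2 = enat n \<and>
        graph_dist \<Gamma> x\<^sub>1 x\<^sub>2 = 2 \<and>
        (\<exists>z\<in>\<Union>\<Gamma>. (x\<^sub>1, z) \<in> adjacency \<Gamma> \<and> (x\<^sub>2, z) \<in> adjacency \<Gamma> \<and>
           graph_dist \<Gamma> x z = enat (n + 1)) \<longrightarrow>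
        (\<exists>y\<in>\<Union>\<Gamma>. graph_dist \<Gamma> y x = enat (n - 1) \<and>
           graph_dist \<Gamma> y x\<^sub>1 = 1 \<and> graph_dist \<Gamma> y x\<^sub>2 = 1)))"

definition weakly_modular :: "'a set set \<Rightarrow> bool" where
  "weakly_modular \<Gamma> \<longleftrightarrow>
    simplicial_graph \<Gamma> \<and> triangle_condition \<Gamma> \<and> quadrangle_condition \<Gamma>"

lemma simplicial_graph_one_skeleton:
  assumes "abstract_simplicial_complex K"
  shows "simplicial_graph (one_skeleton K)"
proof -
  interpret abstract_simplicial_complex K by fact
  show ?thesis
  proof
    fix \<sigma> \<tau> assume "\<sigma> \<in> one_skeleton K" "\<tau> \<subseteq> \<sigma>" "\<tau> \<noteq> {}"
    then show "\<tau> \<in> one_skeleton K"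
      using face[of \<sigma> \<tau>] card_mono[of \<sigma> \<tau>] finite_simplex[of \<sigma>]
      by (auto simp: one_skeleton_def)
  qed (use finite_simplex nonempty_simplex in \<open>auto simp: one_skeleton_def\<close>)
qed


section \<open>Coxeter groups\<close>

text \<open>The entry \<open>0\<close> of a Coxeter matrix stands for \<open>\<infinity>\<close>, that is, for the absence of a relation:
  the relator \<open>(st)\<^sup>0\<close> below is the empty word.\<close>

locale coxeter_matrix =
  fixes I :: "'i set" and M :: "'i \<Rightarrow> 'i \<Rightarrow> nat"
  assumes diag: "s \<in> I \<Longrightarrow> M s s = 1"
    and off_diag: "s \<in> I \<Longrightarrow> t \<in> I \<Longrightarrow> s \<noteq> t \<Longrightarrow> M s t \<noteq> 1"
    and matrix_sym: "s \<in> I \<Longrightarrow> t \<in> I \<Longrightarrow> M s t = M t s"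

text \<open>The congruence on words over \<open>I\<close> generated by the relations \<open>(st)\<^sup>M\<^sup>s\<^sup>t = 1\<close>. As \<open>M s s = 1\<close>,
  the generators are involutions, so formal inverses are not needed and the quotient of the
  word monoid is the Coxeter group presented by \<open>M\<close>.\<close>

inductive word_eq :: "'i set \<Rightarrow> ('i \<Rightarrow> 'i \<Rightarrow> nat) \<Rightarrow> 'i list \<Rightarrow> 'i list \<Rightarrow> bool"
  for I M where
  word_refl: "w \<in> lists I \<Longrightarrow> word_eq I M w w"
| word_sym: "word_eq I M u v \<Longrightarrow> word_eq I M v u"
| word_trans: "word_eq I M u v \<Longrightarrow> word_eq I M v w \<Longrightarrow> word_eq I M u w"
| word_relator: "u \<in> lists I \<Longrightarrow> v \<in> lists I \<Longrightarrow> s \<in> I \<Longrightarrow> t \<in> I \<Longrightarrow>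
    word_eq I M (u @ concat (replicate (M s t) [s, t]) @ v) (u @ v)"

definition word_rel :: "'i set \<Rightarrow> ('i \<Rightarrow> 'i \<Rightarrow> nat) \<Rightarrow> ('i list \<times> 'i list) set" where
  "word_rel I M = {(u, v). word_eq I M u v}"

definition coxeter_group :: "'i set \<Rightarrow> ('i \<Rightarrow> 'i \<Rightarrow> nat) \<Rightarrow> 'i list set monoid" where
  "coxeter_group I M =
    \<lparr>carrier = lists I // word_rel I M,
     mult = (\<lambda>A B. word_rel I M `` {a @ b | a b. a \<in> A \<and> b \<in> B}),
     one = word_rel I M `` {[]}\<rparr>"

definition coxeter_gen :: "'i set \<Rightarrow> ('i \<Rightarrow> 'i \<Rightarrow> nat) \<Rightarrow> 'i \<Rightarrow> 'i list set" where
  "coxeter_gen I M s = word_rel I M `` {[s]}"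

definition parabolic :: "'i set \<Rightarrow> ('i \<Rightarrow> 'i \<Rightarrow> nat) \<Rightarrow> 'i set \<Rightarrow> 'i list set set" where
  "parabolic I M J = generate (coxeter_group I M) (coxeter_gen I M ` J)"

text \<open>The poset of cosets \<open>w W\<^sub>J\<close> with \<open>J \<subset> I\<close>, ordered by reverse inclusion, as a complex. Its
  vertices are the cosets of the maximal standard parabolic subgroups \<open>W\<^bsub>I - {s}\<^esub>\<close>, and \<open>w W\<^sub>J\<close>
  is the simplex whose vertices are the \<open>w W\<^bsub>I - {s}\<^esub>\<close> with \<open>s \<in> T = I - J\<close>.\<close>

definition coxeter_complex :: "'i set \<Rightarrow> ('i \<Rightarrow> 'i \<Rightarrow> nat) \<Rightarrow> 'i list set set set set" where
  "coxeter_complex I M =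
    {(\<lambda>s. w <#\<^bsub>coxeter_group I M\<^esub> parabolic I M (I - {s})) ` T | w T.
       w \<in> carrier (coxeter_group I M) \<and> T \<subseteq> I \<and> T \<noteq> {}}"

lemma abstract_simplicial_complex_coxeter_complex:
  assumes "finite I"
  shows "abstract_simplicial_complex (coxeter_complex I M)"
proof
  fix \<sigma> \<tau> assume \<sigma>: "\<sigma> \<in> coxeter_complex I M" and \<tau>: "\<tau> \<subseteq> \<sigma>" "\<tau> \<noteq> {}"
  from \<sigma> obtain w T where *: "w \<in> carrier (coxeter_group I M)" "T \<subseteq> I"
    "\<sigma> = (\<lambda>s. w <#\<^bsub>coxeter_group I M\<^esub> parabolic I M (I - {s})) ` T"
    unfolding coxeter_complex_def by blast
  from \<tau>(1) *(3) obtain U where "U \<subseteq> T"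
    "\<tau> = (\<lambda>s. w <#\<^bsub>coxeter_group I M\<^esub> parabolic I M (I - {s})) ` U"
    by (metis subset_imageE)
  with * \<tau> show "\<tau> \<in> coxeter_complex I M"
    unfolding coxeter_complex_def by blast
qed (use assms finite_subset in \<open>auto simp: coxeter_complex_def\<close>)

lemma word_eq_lists: "word_eq I M u v \<Longrightarrow> u \<in> lists I \<and> v \<in> lists I"
proof (induction rule: word_eq.induct)
  case (word_relator u v s t)
  then have "set (concat (replicate (M s t) [s, t])) \<subseteq> I" by auto
  with word_relator show ?case by (auto simp: in_lists_conv_set)
qed auto

lemma equiv_word_rel: "equiv (lists I) (word_rel I M)"
proof (rule equivI)
  show "word_rel I M \<subseteq> lists I \<times> lists I"
    using word_eq_lists by (fastforce simp: word_rel_def)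
  show "refl_on (lists I) (word_rel I M)"
    by (auto simp: refl_on_def word_rel_def intro: word_refl)
  show "sym (word_rel I M)"
    by (auto simp: sym_def word_rel_def intro: word_sym)
  show "trans (word_rel I M)"
    unfolding trans_def word_rel_def by (blast intro: word_trans)
qed

lemma word_eq_context:
  assumes "word_eq I M u v" "a \<in> lists I" "b \<in> lists I"
  shows "word_eq I M (a @ u @ b) (a @ v @ b)"
  using assms
proof (induction rule: word_eq.induct)
  case (word_refl w)
  then show ?case by (intro word_eq.word_refl) simp
next
  case (word_relator u v s t)
  then show ?case using word_eq.word_relator[of "a @ u" I "v @ b" s t M] by simp
qed (auto intro: word_eq.intros)

lemma word_eq_append:
  assumes "word_eq I M u u'" "word_eq I M v v'"
  shows "word_eq I M (u @ v) (u' @ v')"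
proof -
  have "word_eq I M (u @ v) (u' @ v)"
    using word_eq_context[OF assms(1), of "[]" v] word_eq_lists[OF assms(2)] by simp
  moreover have "word_eq I M (u' @ v) (u' @ v')"
    using word_eq_context[OF assms(2), of u' "[]"] word_eq_lists[OF assms(1)] by simp
  ultimately show ?thesis by (rule word_trans)
qed

lemma coxeter_group_mult_classes:
  assumes "u \<in> lists I" "v \<in> lists I"
  shows "word_rel I M `` {u} \<otimes>\<^bsub>coxeter_group I M\<^esub> word_rel I M `` {v} = word_rel I M `` {u @ v}"
proof -
  have "word_eq I M (u @ v) w" if "word_eq I M u a" "word_eq I M v b" "word_eq I M (a @ b) w" for a b w
    using that word_eq_append word_trans by metis
  moreover have "word_eq I M u u" "word_eq I M v v" using assms by (auto intro: word_refl)
  ultimately show ?thesis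
    unfolding coxeter_group_def word_rel_def by auto
qed

lemma (in coxeter_matrix) word_eq_rev:
  "w \<in> lists I \<Longrightarrow> word_eq I M (rev w @ w) []"
proof (induction w)
  case (Cons s w)
  then have s: "s \<in> I" "w \<in> lists I" by auto
  have "word_eq I M (rev w @ [s, s] @ w) (rev w @ w)"
    using word_relator[of "rev w" I w s s M] s diag[of s] by (simp add: in_lists_conv_set)
  with Cons s show ?case by (auto intro: word_trans)
qed (auto intro: word_refl)

lemma (in coxeter_matrix) group_coxeter_group: "group (coxeter_group I M)"
proof -
  have carr: "x \<in> carrier (coxeter_group I M) \<longleftrightarrow> (\<exists>u\<in>lists I. x = word_rel I M `` {u})" for x
    by (auto simp: coxeter_group_def quotient_def)
  have one: "\<one>\<^bsub>coxeter_group I M\<^esub> = word_rel I M `` {[]}"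
    by (simp add: coxeter_group_def)
  have inv: "word_rel I M `` {rev u @ u} = word_rel I M `` {[]}" if "u \<in> lists I" for u
    using word_eq_rev[OF that] by (intro equiv_class_eq[OF equiv_word_rel]) (simp add: word_rel_def)
  show ?thesis
  proof (rule groupI)
    fix x assume "x \<in> carrier (coxeter_group I M)"
    then obtain u where u: "u \<in> lists I" "x = word_rel I M `` {u}" using carr by blast
    then have r: "rev u \<in> lists I" by auto
    show "\<exists>y\<in>carrier (coxeter_group I M). y \<otimes>\<^bsub>coxeter_group I M\<^esub> x = \<one>\<^bsub>coxeter_group I M\<^esub>"
    proof
      show "word_rel I M `` {rev u} \<in> carrier (coxeter_group I M)"
        unfolding carr using r by blast
      show "word_rel I M `` {rev u} \<otimes>\<^bsub>coxeter_group I M\<^esub> x = \<one>\<^bsub>coxeter_group I M\<^esub>"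
        unfolding u(2) one coxeter_group_mult_classes[OF r u(1)] by (rule inv[OF u(1)])
    qed
  next
    fix x y assume "x \<in> carrier (coxeter_group I M)" "y \<in> carrier (coxeter_group I M)"
    then obtain u v where "u \<in> lists I" "v \<in> lists I"
      "x = word_rel I M `` {u}" "y = word_rel I M `` {v}"
      unfolding carr by blast
    then show "x \<otimes>\<^bsub>coxeter_group I M\<^esub> y \<in> carrier (coxeter_group I M)"
      unfolding carr by (intro bexI[of _ "u @ v"]) (simp_all add: coxeter_group_mult_classes)
  next
    show "\<one>\<^bsub>coxeter_group I M\<^esub> \<in> carrier (coxeter_group I M)"
      unfolding carr one by auto
  next
    fix x y z assume "x \<in> carrier (coxeter_group I M)" "y \<in> carrier (coxeter_group I M)"
      "z \<in> carrier (coxeter_group I M)"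
    then obtain u v w where *: "u \<in> lists I" "v \<in> lists I" "w \<in> lists I"
      "x = word_rel I M `` {u}" "y = word_rel I M `` {v}" "z = word_rel I M `` {w}"
      unfolding carr by blast
    then show "x \<otimes>\<^bsub>coxeter_group I M\<^esub> y \<otimes>\<^bsub>coxeter_group I M\<^esub> z =
        x \<otimes>\<^bsub>coxeter_group I M\<^esub> (y \<otimes>\<^bsub>coxeter_group I M\<^esub> z)"
      by (simp add: coxeter_group_mult_classes)
  next
    fix x assume "x \<in> carrier (coxeter_group I M)"
    then show "\<one>\<^bsub>coxeter_group I M\<^esub> \<otimes>\<^bsub>coxeter_group I M\<^esub> x = x"
      unfolding carr one using coxeter_group_mult_classes[of "[]" I _ M] by auto
  qed
qed


section \<open>Buildings\<close>

locale apartment_system = abstract_simplicial_complex X + coxeter_matrix I M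
  for X :: "'a set set" and \<A> :: "'a set set set" and I :: "'i set" and M :: "'i \<Rightarrow> 'i \<Rightarrow> nat" +
  assumes apartments_nonempty: "\<A> \<noteq> {}"
    and union_apartments: "X = \<Union>\<A>"
    and apartment_coxeter: "\<Sigma> \<in> \<A> \<Longrightarrow> \<exists>f. simplicial_iso f (coxeter_complex I M) \<Sigma>"
    and common_apartment: "\<sigma> \<in> X \<Longrightarrow> \<tau> \<in> X \<Longrightarrow> \<exists>\<Sigma>\<in>\<A>. \<sigma> \<in> \<Sigma> \<and> \<tau> \<in> \<Sigma>"
    and apartment_iso: "\<Sigma> \<in> \<A> \<Longrightarrow> \<Sigma>' \<in> \<A> \<Longrightarrow>
      \<sigma> \<in> \<Sigma> \<Longrightarrow> \<tau> \<in> \<Sigma> \<Longrightarrow> \<sigma> \<in> \<Sigma>' \<Longrightarrow> \<tau> \<in> \<Sigma>' \<Longrightarrow>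
      \<exists>f. simplicial_iso f \<Sigma> \<Sigma>' \<and> (\<forall>v\<in>\<sigma> \<union> \<tau>. f v = v)"

definition building_of_type :: "'i set \<Rightarrow> ('i \<Rightarrow> 'i \<Rightarrow> nat) \<Rightarrow> 'a set set \<Rightarrow> bool" where
  "building_of_type I M X \<longleftrightarrow> (\<exists>\<A>. apartment_system X \<A> I M)"

text \<open>The Coxeter diagram of type affine \<open>A\<^sub>n\<close> on the nodes \<open>0, \<dots>, n\<close>: for \<open>n \<ge> 2\<close> a cycle of
  length \<open>n + 1\<close> with all edges labelled \<open>3\<close>, for \<open>n = 1\<close> a single edge labelled \<open>\<infinity>\<close>.\<close>

definition affine_A_matrix :: "nat \<Rightarrow> nat \<Rightarrow> nat \<Rightarrow> nat" where
  "affine_A_matrix n i j =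
    (if i = j then 1
     else if n = 1 then 0
     else if j = (i + 1) mod (n + 1) \<or> i = (j + 1) mod (n + 1) then 3
     else 2)"

lemma coxeter_matrix_affine_A: "coxeter_matrix {..n} (affine_A_matrix n)"
  by unfold_locales (auto simp: affine_A_matrix_def)

definition affine_A_building :: "nat \<Rightarrow> 'a set set \<Rightarrow> bool" where
  "affine_A_building n X \<longleftrightarrow> building_of_type {..n} (affine_A_matrix n) X"

end

theory Submission
  imports Defs
begin

text \<open>
  Let \<open>N = n + 1\<close>. The vertices of an apartment are the points of \<open>\<int>\<^sup>N\<close> modulo \<open>(1, \<dots>, 1)\<close>, and the
  distance of \<open>x\<close> and \<open>y\<close> is \<open>max (x - y) - min (x - y)\<close>. The identification rests on the action of
  words on \<open>\<int>\<close> by affine permutations: a word whose permutation has a descent at \<open>i\<close> is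
  equivalent to one ending in \<open>i\<close> with a shorter remainder, so the stabiliser of a vertex of the
  fundamental chamber is the corresponding standard parabolic subgroup.

  In a building, the distance of two vertices is the distance in any apartment containing them,
  because a path can be followed edge by edge through apartments containing its starting vertex.
  As a vertex and an edge lie in a common apartment, the triangle condition can be checked in
  coordinates. For the quadrangle condition, let \<open>d(x, z) = m \<ge> 3\<close>. The neighbour \<open>c\<close> of \<open>x\<close> obtained by
  adding one in the coordinates where \<open>z - x\<close> (normalised to have minimum \<open>0\<close>) is at least \<open>2\<close> is
  closer by one than \<open>x\<close> to \<open>z\<close> and to every neighbour of \<open>z\<close> at distance \<open>m - 1\<close> from \<open>x\<close>. Iterating,
  one arrives at a vertex at distance \<open>m - 2\<close> from \<open>x\<close> that is adjacent to all these neighbours of \<open>z\<close>.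
\<close>

section \<open>Graph distance\<close>

text \<open>With the identity added a path may pause, so \<open>reach R k\<close> expresses distance
  at most \<open>k\<close>. An exact distance then becomes one membership and one
  non-membership.\<close>

abbreviation reach :: "('a \<times> 'a) set \<Rightarrow> nat \<Rightarrow> ('a \<times> 'a) set" where
  "reach R k \<equiv> (R \<union> Id) ^^ k"

lemma reach_iff_relpow: "(u, v) \<in> reach R k \<longleftrightarrow> (\<exists>j\<le>k. (u, v) \<in> R ^^ j)"
proof (induction k arbitrary: v)
  case (Suc k)
  show ?case
  proof
    assume "(u, v) \<in> reach R (Suc k)"
    then obtain t where "(u, t) \<in> reach R k" and tv: "(t, v) \<in> R \<union> Id" by auto
    with Suc.IH obtain j where "j \<le> k" "(u, t) \<in> R ^^ j" by blast
    with tv show "\<exists>j\<le>Suc k. (u, v) \<in> R ^^ j"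
      by (metis UnE le_SucI pair_in_Id_conv not_less_eq_eq relpow_Suc_I)
  next
    assume "\<exists>j\<le>Suc k. (u, v) \<in> R ^^ j"
    then obtain j where j: "j \<le> Suc k" "(u, v) \<in> R ^^ j" by blast
    show "(u, v) \<in> reach R (Suc k)"
    proof (cases "j = Suc k")
      case True
      then obtain t where "(u, t) \<in> R ^^ k" "(t, v) \<in> R" using j by auto
      with Suc.IH[of t] show ?thesis by auto
    next
      case False
      with j Suc.IH[of v] have "(u, v) \<in> reach R k" by (metis le_Suc_eq)
      then show ?thesis by auto
    qed
  qed
qed auto

lemma graph_dist_le_iff: "graph_dist \<Gamma> u v \<le> enat k \<longleftrightarrow> (u, v) \<in> reach (adjacency \<Gamma>) k"
proof
  let ?A = "enat ` {j. (u, v) \<in> adjacency \<Gamma> ^^ j}"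
  assume le: "graph_dist \<Gamma> u v \<le> enat k"
  \<comment> \<open>The infimum of the empty set is infinite. A finite bound makes the set nonempty,
    and its infimum is then a least element, hence attained.\<close>
  then have "?A \<noteq> {}" by (auto simp: graph_dist_def Inf_enat_def split: if_splits)
  then have "Inf ?A \<in> ?A" unfolding Inf_enat_def by (auto intro: LeastI)
  then obtain j where "(u, v) \<in> adjacency \<Gamma> ^^ j" "Inf ?A = enat j" by blast
  with le show "(u, v) \<in> reach (adjacency \<Gamma>) k"
    unfolding reach_iff_relpow graph_dist_def by auto
next
  assume "(u, v) \<in> reach (adjacency \<Gamma>) k"
  then obtain j where "j \<le> k" "(u, v) \<in> adjacency \<Gamma> ^^ j" unfolding reach_iff_relpow by blast
  then have "graph_dist \<Gamma> u v \<le> enat j" unfolding graph_dist_def by (auto intro: Inf_lower)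
  with \<open>j \<le> k\<close> show "graph_dist \<Gamma> u v \<le> enat k" by (meson enat_ord_simps(1) order_trans)
qed

lemma graph_dist_eq_Suc_iff:
  "graph_dist \<Gamma> u v = enat (Suc k) \<longleftrightarrow>
    (u, v) \<in> reach (adjacency \<Gamma>) (Suc k) \<and> (u, v) \<notin> reach (adjacency \<Gamma>) k"
  unfolding graph_dist_le_iff[symmetric]
  by (cases "graph_dist \<Gamma> u v") auto

lemma reach_mono: "j \<le> k \<Longrightarrow> (u, v) \<in> reach R j \<Longrightarrow> (u, v) \<in> reach R k"
  unfolding reach_iff_relpow by (meson order_trans)

lemma reach_trans: "(u, v) \<in> reach R j \<Longrightarrow> (v, w) \<in> reach R k \<Longrightarrow> (u, w) \<in> reach R (j + k)"
  by (auto simp: relpow_add)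

lemma sym_adjacency: "sym (adjacency \<Gamma>)"
  by (auto simp: sym_def adjacency_def insert_commute)

lemma sym_reach: "sym R \<Longrightarrow> (u, v) \<in> reach R k \<Longrightarrow> (v, u) \<in> reach R k"
proof (induction k arbitrary: v)
  case (Suc k)
  then obtain t where "(u, t) \<in> reach R k" "(t, v) \<in> R \<union> Id" by auto
  with Suc have "(t, u) \<in> reach R k" "(v, t) \<in> R \<union> Id" by (auto simp: sym_def)
  then show ?case by (meson relpow_Suc_I2)
qed auto

lemma reach_subset_mono: "R \<subseteq> S \<Longrightarrow> reach R k \<subseteq> reach S k"
proof (induction k)
  case (Suc k)
  then show ?case by (auto intro: relpow_Suc_I)
qed auto

lemma reach_image:
  assumes "\<And>u v. (u, v) \<in> R \<Longrightarrow> (f u, f v) \<in> S" "(u, v) \<in> reach R k"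
  shows "(f u, f v) \<in> reach S k"
  using assms(2)
proof (induction k arbitrary: v)
  case (Suc k)
  then obtain t where "(f u, f t) \<in> reach S k" "(t, v) \<in> R \<union> Id" by auto
  moreover from this(2) have "(f t, f v) \<in> S \<union> Id" using assms(1) by auto
  ultimately show ?case by auto
qed auto

lemma adjacency_one_skeleton: "adjacency (one_skeleton K) = adjacency K"
  by (auto simp: adjacency_def one_skeleton_def)

section \<open>Affine permutations\<close>

text \<open>The simple reflection of the affine symmetric group: it exchanges \<open>k - 1\<close>
  and \<open>k\<close> for every \<open>k\<close> congruent to \<open>i\<close>, the residue
  \<open>N - 1\<close> being that of \<open>i - 1\<close>. For \<open>N = 2\<close> these two
  residues are all of them, so no integer is fixed.\<close>

definition affine_swap :: "int \<Rightarrow> int \<Rightarrow> int \<Rightarrow> int" where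
  "affine_swap N i k = (if (k - i) mod N = 0 then k - 1 else if (k - i) mod N = N - 1 then k + 1 else k)"

lemma mod_add_if:
  fixes a b N :: int
  assumes "N > 0"
  shows "(a + b) mod N = (if a mod N + b mod N < N then a mod N + b mod N else a mod N + b mod N - N)"
proof -
  have "(a + b) mod N = (a mod N + b mod N) mod N" by (simp add: mod_add_eq)
  also have "\<dots> = (if a mod N + b mod N < N then a mod N + b mod N else a mod N + b mod N - N)"
  proof (cases "a mod N + b mod N < N")
    case True
    then show ?thesis using assms by (simp add: mod_pos_pos_trivial)
  next
    case False
    then have "(a mod N + b mod N) mod N = (a mod N + b mod N - N) mod N" by simp
    also have "\<dots> = a mod N + b mod N - N"
      using False pos_mod_bound[OF assms, of a] pos_mod_bound[OF assms, of b]
      by (intro mod_pos_pos_trivial) auto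
    finally show ?thesis using False by simp
  qed
  finally show ?thesis .
qed

lemma mod_succ:
  assumes "(N::int) \<ge> 2"
  shows "(a + 1) mod N = (if a mod N = N - 1 then 0 else a mod N + 1)"
proof -
  have "1 mod N = 1" using assms by simp
  moreover have "a mod N < N" using assms by simp
  moreover have "(a + 1) mod N =
      (if a mod N + 1 mod N < N then a mod N + 1 mod N else a mod N + 1 mod N - N)"
    using assms by (intro mod_add_if) simp
  ultimately show ?thesis by (simp del: pos_mod_bound)
qed

lemma mod_pred:
  assumes "(N::int) \<ge> 2"
  shows "(a - 1) mod N = (if a mod N = 0 then N - 1 else a mod N - 1)"
proof -
  have "(a - 1) mod N \<ge> 0" using assms by simp
  then show ?thesis using mod_succ[OF assms, of "a - 1"] by (simp split: if_splits)
qed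

lemma affine_swap_cong:
  assumes "i mod N = j mod N"
  shows "affine_swap N i = affine_swap N j"
proof -
  have "(k - i) mod N = (k - j) mod N" for k
    using assms by (metis mod_diff_right_eq)
  then show ?thesis by (auto simp: affine_swap_def fun_eq_iff)
qed

lemma affine_swap_invol:
  assumes "N \<ge> 2"
  shows "affine_swap N i (affine_swap N i k) = k"
proof -
  have e: "(k - 1 - i) mod N = (k - i - 1) mod N" "(k + 1 - i) mod N = (k - i + 1) mod N"
    by (simp_all add: algebra_simps)
  show ?thesis using assms unfolding affine_swap_def
    by (simp add: e mod_succ mod_pred)
qed

lemma affine_swap_add: "affine_swap N i (k + N) = affine_swap N i k + N"
proof -
  have "(k + N - i) mod N = (k - i) mod N"
    by (metis diff_add_eq mod_add_self2)
  then show ?thesis by (simp add: affine_swap_def)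
qed

text \<open>Modulo \<open>N\<close>, both sides exchange \<open>i - 1\<close> with
  \<open>i + 1\<close> and fix \<open>i\<close>. The bound \<open>N \<ge> 3\<close> keeps these
  three residues distinct.\<close>

lemma affine_swap_braid:
  assumes "N \<ge> 3"
  shows "affine_swap N i (affine_swap N (i + 1) (affine_swap N i k)) =
    affine_swap N (i + 1) (affine_swap N i (affine_swap N (i + 1) k))"
proof -
  define r where "r x = (x - i) mod N" for x
  have r: "0 \<le> r x" "r x < N" for x using assms by (auto simp: r_def)
  have succ: "r (x + 1) = (if r x = N - 1 then 0 else r x + 1)" for x
    using mod_succ[of N "x - i"] assms by (simp add: r_def algebra_simps)
  have pred: "r (x - 1) = (if r x = 0 then N - 1 else r x - 1)" for x
    using mod_pred[of N "x - i"] assms by (simp add: r_def algebra_simps)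
  have S: "affine_swap N i x = (if r x = 0 then x - 1 else if r x = N - 1 then x + 1 else x)" for x
    by (simp add: affine_swap_def r_def)
  have T: "affine_swap N (i + 1) x = (if r x = 1 then x - 1 else if r x = 0 then x + 1 else x)" for x
  proof -
    have "affine_swap N (i + 1) x = (if r (x - 1) = 0 then x - 1 else if r (x - 1) = N - 1 then x + 1 else x)"
      by (simp add: affine_swap_def r_def algebra_simps)
    then show ?thesis using pred[of x] r[of x] assms by (simp split: if_splits)
  qed
  consider "r k = 0" | "r k = 1" | "r k = N - 1" "r k \<noteq> 1" "r k \<noteq> 0"
    | "r k \<noteq> 0" "r k \<noteq> 1" "r k \<noteq> N - 1" by blast
  then show ?thesis
  proof cases
    case 1
    have "affine_swap N i k = k - 1" "affine_swap N (i + 1) k = k + 1" using 1 by (auto simp: S T)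
    moreover have "affine_swap N (i + 1) (k - 1) = k - 1" "affine_swap N i (k - 1) = k"
      using 1 pred[of k] assms by (auto simp: S T)
    moreover have "affine_swap N i (k + 1) = k + 1" "affine_swap N (i + 1) (k + 1) = k"
      using 1 succ[of k] assms by (auto simp: S T)
    ultimately show ?thesis by simp
  next
    case 2
    have "affine_swap N i k = k" "affine_swap N (i + 1) k = k - 1" using 2 assms by (auto simp: S T)
    moreover have p: "r (k - 1) = 0" using 2 pred[of k] by simp
    then have "affine_swap N i (k - 1) = k - 1 - 1" by (simp add: S)
    moreover have "affine_swap N (i + 1) (k - 1 - 1) = k - 1 - 1"
      using p pred[of "k - 1"] assms by (simp add: T)
    ultimately show ?thesis by simp
  next
    case 3
    have "affine_swap N i k = k + 1" "affine_swap N (i + 1) k = k" using 3 by (auto simp: S T)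
    moreover have p: "r (k + 1) = 0" using 3 succ[of k] by simp
    then have "affine_swap N (i + 1) (k + 1) = k + 1 + 1" by (simp add: T)
    moreover have "affine_swap N i (k + 1 + 1) = k + 1 + 1"
      using p succ[of "k + 1"] assms by (simp add: S)
    ultimately show ?thesis by simp
  next
    case 4
    then show ?thesis by (simp add: S T)
  qed
qed

text \<open>The residues of \<open>i - 1\<close>, \<open>i\<close> and of \<open>j - 1\<close>,
  \<open>j\<close> form disjoint pairs, so a point moved by one swap is fixed by the other, both
  before and after its move. The facts \<open>rs\<close> record this.\<close>

lemma affine_swap_commute:
  assumes "N \<ge> 2" "(i - j) mod N \<notin> {0, 1, N - 1}"
  shows "affine_swap N i (affine_swap N j k) = affine_swap N j (affine_swap N i k)"
proof -
  define r s d where "r = (k - i) mod N" and "s = (k - j) mod N" and "d = (i - j) mod N"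
  have bounds: "0 \<le> r" "r < N" "0 \<le> s" "s < N" "0 \<le> d" "d < N"
    using assms by (auto simp: r_def s_def d_def)
  have "k - j = (k - i) + (i - j)" by simp
  then have s: "s = (if r + d < N then r + d else r + d - N)"
    using assms unfolding r_def s_def d_def
    by (metis mod_add_if not_numeral_le_zero order_less_le_trans zero_less_numeral)
  have d: "d \<noteq> 0" "d \<noteq> 1" "d \<noteq> N - 1" using assms by (auto simp: d_def)
  have step: "(k - 1 - i) mod N = (if r = 0 then N - 1 else r - 1)"
    "(k + 1 - i) mod N = (if r = N - 1 then 0 else r + 1)"
    "(k - 1 - j) mod N = (if s = 0 then N - 1 else s - 1)"
    "(k + 1 - j) mod N = (if s = N - 1 then 0 else s + 1)"
    using mod_pred[OF assms(1), of "k - i"] mod_succ[OF assms(1), of "k - i"]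
      mod_pred[OF assms(1), of "k - j"] mod_succ[OF assms(1), of "k - j"]
    by (simp_all add: r_def s_def algebra_simps)
  note v = affine_swap_def r_def[symmetric] s_def[symmetric] step
  have rs: "\<not> (r = 0 \<and> s = 0)" "\<not> (r = 0 \<and> s = N - 1)" "\<not> (r = N - 1 \<and> s = 0)" "\<not> (r = N - 1 \<and> s = N - 1)"
    "r = 0 \<Longrightarrow> s \<noteq> 1" "r = N - 1 \<Longrightarrow> s \<noteq> N - 2" "s = 0 \<Longrightarrow> r \<noteq> 1" "s = N - 1 \<Longrightarrow> r \<noteq> N - 2"
    using s d bounds by (auto split: if_splits)
  consider "r = 0" | "r = N - 1" | "r \<noteq> 0" "r \<noteq> N - 1" "s = 0" | "r \<noteq> 0" "r \<noteq> N - 1" "s = N - 1"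
    | "r \<noteq> 0" "r \<noteq> N - 1" "s \<noteq> 0" "s \<noteq> N - 1" by blast
  then show ?thesis
  proof cases
    case 1
    then show ?thesis using rs bounds assms(1) by (simp add: v)
  next
    case 2
    then show ?thesis using rs bounds assms(1) by (simp add: v)
  next
    case 3
    then show ?thesis using rs bounds assms(1) by (simp add: v)
  next
    case 4
    then show ?thesis using rs bounds assms(1) by (simp add: v)
  next
    case 5
    then show ?thesis by (simp add: v)
  qed
qed

section \<open>Words and their affine permutations\<close>

context coxeter_matrix
begin

text \<open>The word \<open>[s, t, s, t, t, s]\<close> reduces in two ways: its last four letters
  cancel, and its first four form the relator. The braid relation is obtained in the same way from
  nine letters.\<close>

lemma word_eq_commute:
  assumes "s \<in> I" "t \<in> I" "M s t = 2"
  shows "word_eq I M [s, t] [t, s]"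
proof -
  have "word_eq I M ([s, t] @ [s, t] @ [t, s]) ([s, t] @ [])"
    using word_eq_context[OF word_eq_rev[of "[t, s]"], of "[s, t]" "[]"] assms by simp
  moreover have "word_eq I M ([] @ [s, t, s, t] @ [t, s]) ([] @ [t, s])"
    using word_relator[of "[]" I "[t, s]" s t M] assms by (simp add: numeral_2_eq_2)
  ultimately show ?thesis by (metis append_Cons append_Nil append_Nil2 word_sym word_trans)
qed

lemma word_eq_braid:
  assumes "s \<in> I" "t \<in> I" "M s t = 3"
  shows "word_eq I M [s, t, s] [t, s, t]"
proof -
  have "word_eq I M ([s, t, s] @ [t, s, t] @ [t, s, t]) ([s, t, s] @ [])"
    using word_eq_context[OF word_eq_rev[of "[t, s, t]"], of "[s, t, s]" "[]"] assms by simp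
  moreover have "word_eq I M ([] @ [s, t, s, t, s, t] @ [t, s, t]) ([] @ [t, s, t])"
    using word_relator[of "[]" I "[t, s, t]" s t M] assms by (simp add: numeral_3_eq_3)
  ultimately show ?thesis by (metis append_Cons append_Nil append_Nil2 word_sym word_trans)
qed

lemma word_eq_square: "s \<in> I \<Longrightarrow> word_eq I M [s, s] []"
  using word_eq_rev[of "[s]"] by simp

end

section \<open>The affine symmetric group acting on the integers\<close>

locale affine_A =
  fixes n :: nat
  assumes n_pos: "n \<ge> 1"
begin

definition N :: int where "N = int (n + 1)"

abbreviation M :: "nat \<Rightarrow> nat \<Rightarrow> nat" where "M \<equiv> affine_A_matrix n"

abbreviation eq_word :: "nat list \<Rightarrow> nat list \<Rightarrow> bool" (infix \<open>\<approx>\<close> 50) where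
  "u \<approx> v \<equiv> word_eq {..n} M u v"

sublocale coxeter_matrix "{..n}" M
  by (rule coxeter_matrix_affine_A)

lemma N_ge_2: "N \<ge> 2" using n_pos by (simp add: N_def)

text \<open>The homomorphism from words to affine permutations, the last letter being applied first.
  Appending a letter to a word therefore exchanges neighbouring arguments, which is why descents
  compare neighbouring values.\<close>

definition act :: "nat list \<Rightarrow> int \<Rightarrow> int" where
  "act u = foldr (\<lambda>i p. affine_swap N (int i) \<circ> p) u id"

lemma act_Nil [simp]: "act [] = id"
  and act_Cons: "act (i # u) = affine_swap N (int i) \<circ> act u"
  by (simp_all add: act_def)

lemma act_append: "act (u @ v) = act u \<circ> act v"
  by (induction u) (auto simp: act_Cons)

lemma act_single: "act [i] = affine_swap N (int i)"
  by (simp add: act_Cons)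

lemma act_rev: "act (rev u) (act u k) = k"
  by (induction u arbitrary: k) (simp_all add: act_append act_Cons affine_swap_invol[OF N_ge_2])

lemma act_rev': "act u (act (rev u) k) = k"
  using act_rev[of "rev u"] by simp

lemma bij_act: "bij (act u)"
  by (rule bijI') (metis act_rev, metis act_rev')

lemma act_add: "act u (k + N) = act u k + N"
  by (induction u arbitrary: k) (simp_all add: act_Cons affine_swap_add)

lemma act_add_mult: "act u (k + N * m) = act u k + N * m"
proof (induction m rule: int_induct[where k = 0])
  case (step1 i)
  then show ?case using act_add[of u "k + N * i"] by (simp add: algebra_simps)
next
  case (step2 i)
  then show ?case using act_add[of u "k + N * (i - 1)"] by (simp add: algebra_simps)
qed simp

text \<open>Translates the cyclic order of the diagram nodes, as it appears in
  \<open>affine_A_matrix\<close>, into the residues modulo \<open>N\<close> that govern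
  \<open>affine_swap\<close>.\<close>

lemma letter_succ_iff:
  assumes "s \<le> n" "t \<le> n"
  shows "(int s - int t) mod N = 1 \<longleftrightarrow> s = (t + 1) mod (n + 1)"
proof -
  have 1: "1 mod N = 1" using N_ge_2 by simp
  have "(int s - int t) mod N = 1 \<longleftrightarrow> N dvd (int s - int t - 1)"
    using 1 mod_eq_dvd_iff[of "int s - int t" N 1] by simp
  also have "\<dots> \<longleftrightarrow> int s mod N = (int t + 1) mod N"
    using mod_eq_dvd_iff[of "int s" N "int t + 1"] by (simp add: algebra_simps)
  also have "\<dots> \<longleftrightarrow> int (s mod (n + 1)) = int ((t + 1) mod (n + 1))"
    by (simp add: zmod_int N_def add.commute)
  also have "\<dots> \<longleftrightarrow> s = (t + 1) mod (n + 1)"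
    using assms unfolding of_nat_eq_iff by simp
  finally show ?thesis .
qed

lemma affine_swap_letter_succ:
  "s \<le> n \<Longrightarrow> t \<le> n \<Longrightarrow> s = (t + 1) mod (n + 1) \<Longrightarrow> affine_swap N (int s) = affine_swap N (int t + 1)"
proof (rule affine_swap_cong)
  assume "s = (t + 1) mod (n + 1)"
  then have "int s = (int t + 1) mod N" by (simp add: zmod_int N_def add.commute)
  then show "int s mod N = (int t + 1) mod N" by simp
qed

lemma act_braid:
  assumes "s \<le> n" "t \<le> n" "n \<ge> 2" "s = (t + 1) mod (n + 1) \<or> t = (s + 1) mod (n + 1)"
  shows "act [s, t, s] = act [t, s, t]"
proof -
  have N: "N \<ge> 3" using assms by (simp add: N_def)
  from assms(4) show ?thesis
  proof
    assume "s = (t + 1) mod (n + 1)"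
    then show ?thesis
      using affine_swap_braid[OF N, of "int t"] affine_swap_letter_succ[of s t] assms
      by (auto simp: act_Cons fun_eq_iff)
  next
    assume "t = (s + 1) mod (n + 1)"
    then show ?thesis
      using affine_swap_braid[OF N, of "int s"] affine_swap_letter_succ[of t s] assms
      by (auto simp: act_Cons fun_eq_iff)
  qed
qed

lemma act_commute:
  assumes "s \<le> n" "t \<le> n" "s \<noteq> t" "s \<noteq> (t + 1) mod (n + 1)" "t \<noteq> (s + 1) mod (n + 1)"
  shows "act [s, t] = act [t, s]"
proof -
  have "(int s - int t) mod N \<noteq> 0"
    using assms(1-3) mod_eq_dvd_iff[of "int s" N "int t"] by (simp add: N_def mod_eq_0_iff_dvd)
  moreover have "(int s - int t) mod N \<noteq> 1" "(int t - int s) mod N \<noteq> 1"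
    using letter_succ_iff assms by auto
  moreover from this(2) have "(int s - int t) mod N \<noteq> N - 1"
    using zmod_zminus1_eq_if[of "int s - int t" N] N_ge_2 by (auto split: if_splits)
  ultimately have "affine_swap N (int s) (affine_swap N (int t) k) =
      affine_swap N (int t) (affine_swap N (int s) k)" for k
    by (intro affine_swap_commute N_ge_2) auto
  then show ?thesis by (auto simp: act_Cons fun_eq_iff)
qed

text \<open>By the braid or the commutation relation, the second half of the relator acts as the
  reversal of its first half, hence as its inverse. The entry \<open>0\<close>, which occurs for
  \<open>n = 1\<close>, gives the empty word.\<close>

lemma act_relator:
  assumes "s \<le> n" "t \<le> n"
  shows "act (concat (replicate (M s t) [s, t])) = id"
proof -
  have sq: "act (u @ rev u) = id" for u by (simp add: act_append fun_eq_iff act_rev')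
  consider "s = t" | "M s t = 0"
    | "s \<noteq> t" "M s t = 3" "n \<ge> 2" "s = (t + 1) mod (n + 1) \<or> t = (s + 1) mod (n + 1)"
    | "s \<noteq> t" "M s t = 2" "s \<noteq> (t + 1) mod (n + 1)" "t \<noteq> (s + 1) mod (n + 1)"
    using n_pos unfolding affine_A_matrix_def
    by (cases "s = t"; cases "n = 1";
        cases "t = (s + 1) mod (n + 1) \<or> s = (t + 1) mod (n + 1)") auto
  then show ?thesis
  proof cases
    case 1
    then show ?thesis using sq[of "[s]"] assms diag by simp
  next
    case 3
    have "act ([s, t, s] @ [t, s, t]) = act ([s, t, s] @ rev [s, t, s])"
      unfolding act_append using act_braid[OF assms 3(3,4)] by simp
    then show ?thesis using 3 sq[of "[s, t, s]"] by (simp add: numeral_3_eq_3)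
  next
    case 4
    have "act ([s, t] @ [s, t]) = act ([s, t] @ rev [s, t])"
      unfolding act_append using act_commute[OF assms 4(1,3,4)] by simp
    then show ?thesis using 4 sq[of "[s, t]"] by (simp add: numeral_2_eq_2)
  qed simp
qed

lemma act_word_eq: "u \<approx> v \<Longrightarrow> act u = act v"
  by (induction rule: word_eq.induct) (auto simp: act_append act_relator)

end

lemma affine_swap_self: "affine_swap N i i = i - 1"
  by (simp add: affine_swap_def)

lemma affine_swap_pred_self: "N \<ge> 2 \<Longrightarrow> affine_swap N i (i - 1) = i"
  using affine_swap_invol[of N i i] by (simp add: affine_swap_self)

lemma affine_swap_fixed: "(k - i) mod N \<notin> {0, N - 1} \<Longrightarrow> affine_swap N i k = k"
  by (simp add: affine_swap_def)

lemma minus_two_mod: "(N::int) \<ge> 3 \<Longrightarrow> (- 2) mod N = N - 2"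
  using mod_pred[of N "-1"] mod_pred[of N 0] by simp

text \<open>Only an exchange of \<open>s - 1\<close> and \<open>s\<close> carries an integer across
  the threshold \<open>s\<close>, and this happens only if \<open>s\<close> is congruent to
  \<open>i\<close>.\<close>

lemma affine_swap_lessThan:
  assumes "N \<ge> 2" "(s - i) mod N \<noteq> 0"
  shows "affine_swap N i ` {..<s} = {..<s}"
proof -
  have "(s - 1 - i) mod N \<noteq> N - 1"
    using mod_succ[OF assms(1), of "s - 1 - i"] assms(2) by (auto simp: algebra_simps)
  then have "affine_swap N i k < s" if "k < s" for k
    using that by (cases "k = s - 1") (auto simp: affine_swap_def)
  then show ?thesis
    using affine_swap_invol[OF assms(1), of i]
    by (metis image_subset_iff lessThan_iff subsetI subset_antisym image_eqI)
qed

context affine_A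
begin

subsection \<open>Descents\<close>

text \<open>The letter \<open>i\<close> exchanges the positions \<open>i - 1\<close> and \<open>i\<close> modulo \<open>N\<close>.\<close>

definition descent :: "nat list \<Rightarrow> nat \<Rightarrow> bool" where
  "descent u i \<longleftrightarrow> act u (int i) < act u (int i - 1)"

lemma inj_act: "act u x = act u y \<longleftrightarrow> x = y"
  using bij_act[of u] by (meson bij_def injD)

lemma act_shift_cong:
  assumes "N dvd (k - l)"
  shows "act u (k - 1) - act u k = act u (l - 1) - act u l"
proof -
  from assms obtain m where "k = l + N * m" by (metis add.commute diff_eq_eq dvdE)
  then show ?thesis using act_add_mult[of u l m] act_add_mult[of u "l - 1" m]
    by (simp add: algebra_simps)
qed

lemma descent_cong: "(k - int i) mod N = 0 \<Longrightarrow> descent u i \<longleftrightarrow> act u k < act u (k - 1)"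
  using act_shift_cong[of k "int i" u] unfolding descent_def mod_eq_0_iff_dvd by linarith

lemma letter_succ_imp_dvd:
  assumes "s \<le> n" "t \<le> n" "s = (t + 1) mod (n + 1)"
  shows "(int t + 1 - int s) mod N = 0"
proof -
  have "1 mod N = 1" using N_ge_2 by simp
  with letter_succ_iff[of s t] assms have "N dvd (int s - int t - 1)"
    by (metis mod_eq_dvd_iff)
  then have "N dvd - (int s - int t - 1)" by (simp only: dvd_minus_iff)
  then show ?thesis by (simp add: algebra_simps mod_eq_0_iff_dvd)
qed

lemma N_ge_3:
  assumes "n \<ge> 2"
  shows "(1::int) mod N = 1" "N \<ge> 3"
  using assms by (auto simp: N_def)

text \<open>Three consecutive values are compared. Let \<open>n \<ge> 2\<close>,
  \<open>x = int i\<close>, and let \<open>j\<close> follow \<open>i\<close> cyclically. Then the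
  descent of \<open>v @ [j]\<close> at \<open>i\<close> says that \<open>v\<close> has a smaller
  value at \<open>x + 1\<close> than at \<open>x - 1\<close>. If \<open>v\<close> ascends at
  \<open>i\<close>, it must drop from \<open>x\<close> to \<open>x + 1\<close>. If \<open>v\<close>
  acts as \<open>w @ [i]\<close>, the same inequality compares the values of \<open>w\<close> at
  \<open>x + 1\<close> and \<open>x\<close>.\<close>

lemma descent_neighbour:
  assumes "i \<le> n" "j \<le> n" "i = (j + 1) mod (n + 1) \<or> j = (i + 1) mod (n + 1)"
    and "descent (v @ [j]) i"
  shows descent_neighbour1: "\<not> descent v i \<Longrightarrow> descent v j"
    and descent_neighbour2: "descent v i \<Longrightarrow> n \<ge> 2"
    and descent_neighbour3: "descent v i \<Longrightarrow> act v = act (w @ [i]) \<Longrightarrow> descent w j"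
proof -
  define x where "x = int i"
  have Dv: "descent v i \<longleftrightarrow> act v x < act v (x - 1)" by (simp add: descent_def x_def)
  have wi: "act v x = act w (x - 1) \<and> act v (x - 1) = act w x \<and>
      (n \<ge> 2 \<longrightarrow> act v (x + 1) = act w (x + 1) \<and> act v (x - 2) = act w (x - 2))"
    if "act v = act (w @ [i])"
  proof -
    have "affine_swap N x (x + 1) = x + 1" "affine_swap N x (x - 2) = x - 2" if "n \<ge> 2"
      using N_ge_3[OF that] minus_two_mod[of N] by (auto intro!: affine_swap_fixed)
    then show ?thesis
      using that affine_swap_pred_self[OF N_ge_2] by (auto simp: act_append act_single affine_swap_self x_def)
  qed
  have main: "(\<not> descent v i \<longrightarrow> descent v j) \<and> (descent v i \<longrightarrow> n \<ge> 2) \<and>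
      (descent v i \<longrightarrow> act v = act (w @ [i]) \<longrightarrow> descent w j)"
    using assms(3)
  proof
    assume ij: "i = (j + 1) mod (n + 1)"
    have e: "(x - 1 - int j) mod N = 0"
      using letter_succ_imp_dvd[OF assms(1,2) ij]
      by (simp add: mod_eq_0_iff_dvd x_def dvd_diff_commute algebra_simps)
    then have sj: "affine_swap N (int j) = affine_swap N (x - 1)"
      by (intro affine_swap_cong) (simp add: mod_eq_dvd_iff mod_eq_0_iff_dvd dvd_diff_commute)
    have D: "descent u j \<longleftrightarrow> act u (x - 1) < act u (x - 2)" for u
      using descent_cong[OF e] by simp
    have 1: "act (v @ [j]) (x - 1) = act v (x - 2)"
      by (simp add: act_append act_single sj affine_swap_self)
    show ?thesis
    proof (cases "n \<ge> 2")
      case True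
      have "affine_swap N (x - 1) x = x"
        using N_ge_3[OF True] by (intro affine_swap_fixed) auto
      then have "act (v @ [j]) x = act v x" by (simp add: act_append act_single sj)
      with 1 assms(4) have "act v x < act v (x - 2)" by (simp add: descent_def x_def)
      then show ?thesis using True wi by (auto simp: D Dv)
    next
      case False
      then have N2: "N = 2" using n_pos by (simp add: N_def)
      \<comment> \<open>With period \<open>2\<close> the letter \<open>j\<close> moves
        \<open>x\<close> as well. Periodicity turns the assumed descent into an inequality that
        makes \<open>v\<close> ascend at \<open>i\<close>, so the claims about a descent of
        \<open>v\<close> at \<open>i\<close> hold vacuously.\<close>
      have "affine_swap N (x - 1) x = x + 1" by (simp add: affine_swap_def N2)
      then have "act (v @ [j]) x = act v (x + 1)" by (simp add: act_append act_single sj)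
      with 1 assms(4) have "act v (x + 1) < act v (x - 2)" by (simp add: descent_def x_def)
      moreover have "act v (x + 1) = act v (x - 1) + 2" "act v x = act v (x - 2) + 2"
        using act_add[of v "x - 1"] act_add[of v "x - 2"] by (simp_all add: N2 add.commute)
      ultimately show ?thesis using False unfolding D Dv by linarith
    qed
  next
    assume ij: "j = (i + 1) mod (n + 1)"
    have e: "(x + 1 - int j) mod N = 0"
      using letter_succ_imp_dvd[OF assms(2,1) ij] by (simp add: x_def)
    then have sj: "affine_swap N (int j) = affine_swap N (x + 1)"
      by (intro affine_swap_cong) (simp add: mod_eq_dvd_iff mod_eq_0_iff_dvd dvd_diff_commute)
    have D: "descent u j \<longleftrightarrow> act u (x + 1) < act u x" for u
      using descent_cong[OF e] by simp
    have 1: "act (v @ [j]) x = act v (x + 1)"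
      using affine_swap_pred_self[OF N_ge_2, of "x + 1"] by (simp add: act_append act_single sj)
    show ?thesis
    proof (cases "n \<ge> 2")
      case True
      have "affine_swap N (x + 1) (x - 1) = x - 1"
        using N_ge_3[OF True] minus_two_mod[of N] by (intro affine_swap_fixed) auto
      then have "act (v @ [j]) (x - 1) = act v (x - 1)" by (simp add: act_append act_single sj)
      with 1 assms(4) have "act v (x + 1) < act v (x - 1)" by (simp add: descent_def x_def)
      then show ?thesis using True wi by (auto simp: D Dv)
    next
      case False
      then have N2: "N = 2" using n_pos by (simp add: N_def)
      have "affine_swap N (x + 1) (x - 1) = x - 2" by (simp add: affine_swap_def N2)
      then have "act (v @ [j]) (x - 1) = act v (x - 2)" by (simp add: act_append act_single sj)
      with 1 assms(4) have "act v (x + 1) < act v (x - 2)" by (simp add: descent_def x_def)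
      moreover have "act v (x + 1) = act v (x - 1) + 2" "act v x = act v (x - 2) + 2"
        using act_add[of v "x - 1"] act_add[of v "x - 2"] by (simp_all add: N2 add.commute)
      ultimately show ?thesis using False unfolding D Dv by linarith
    qed
  qed
  show "\<not> descent v i \<Longrightarrow> descent v j" "descent v i \<Longrightarrow> n \<ge> 2"
    "descent v i \<Longrightarrow> act v = act (w @ [i]) \<Longrightarrow> descent w j"
    using main by blast+
qed

lemma descent_word_eq: "u \<approx> v \<Longrightarrow> descent u i \<longleftrightarrow> descent v i"
  by (simp add: descent_def act_word_eq)

lemma eq_word_append_right: "u \<approx> v \<Longrightarrow> w \<in> lists {..n} \<Longrightarrow> u @ w \<approx> v @ w"
  by (rule word_eq_append[OF _ word_refl])

lemma eq_word_append_left: "u \<approx> v \<Longrightarrow> w \<in> lists {..n} \<Longrightarrow> w @ u \<approx> w @ v"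
  by (rule word_eq_append[OF word_refl])

lemma cancel_square: "v \<approx> w @ [j] \<Longrightarrow> v @ [j] \<approx> w"
proof -
  assume v: "v \<approx> w @ [j]"
  then have l: "w \<in> lists {..n}" "j \<in> {..n}" using word_eq_lists[OF v] by auto
  then have "v @ [j] \<approx> w @ [j, j]" using eq_word_append_right[OF v, of "[j]"] by simp
  moreover have "w @ [j, j] \<approx> w"
    using eq_word_append_left[OF word_eq_square[OF l(2)] l(1)] by simp
  ultimately show ?thesis by (rule word_trans)
qed

text \<open>The exchange property, read off from the permutation. The last letter \<open>j\<close>
  of \<open>u\<close> is compared with \<open>i\<close>: if they are equal, nothing remains to be
  done; if they commute, \<open>i\<close> is moved past \<open>j\<close>; if they are neighbours in
  the diagram, either a braid move applies or \<open>u\<close> can be shortened by a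
  cancellation.\<close>

lemma descent_imp_suffix:
  assumes "u \<in> lists {..n}" "i \<le> n" "descent u i"
  shows "\<exists>v\<in>lists {..n}. length v < length u \<and> u \<approx> v @ [i]"
  using assms
proof (induction u arbitrary: i rule: length_induct)
  case (1 u)
  note IH = "1.IH"[rule_format] and [trans] = word_trans
  have "u \<noteq> []" using "1.prems"(3) by (auto simp: descent_def)
  then obtain v j where u: "u = v @ [j]" by (metis rev_exhaust)
  with "1.prems" have v: "v \<in> lists {..n}" "j \<le> n" by auto
  consider "j = i" | "i = (j + 1) mod (n + 1) \<or> j = (i + 1) mod (n + 1)" "i \<noteq> j"
    | "i \<noteq> j" "i \<noteq> (j + 1) mod (n + 1)" "j \<noteq> (i + 1) mod (n + 1)"
    by blast
  then show ?case
  proof cases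
    case 1
    then have "u \<approx> v @ [i]" using word_refl[OF "1.prems"(1)] u by simp
    then show ?thesis using u v by (intro bexI[of _ v]) auto
  next
    case 2
    note nb = "1.prems"(2) v(2) 2(1) "1.prems"(3)[unfolded u]
    show ?thesis
    proof (cases "descent v i")
      case True
      then obtain w where w: "w \<in> lists {..n}" "length w < length v" "v \<approx> w @ [i]"
        using IH[of v i] u v "1.prems" by auto
      have n2: "n \<ge> 2" using descent_neighbour2[OF nb True] .
      have "descent w j" using descent_neighbour3[OF nb True act_word_eq[OF w(3)]] .
      then obtain w' where w': "w' \<in> lists {..n}" "length w' < length w" "w \<approx> w' @ [j]"
        using IH[of w j] u v w by auto
      have "M j i = 3" using 2 n2 by (auto simp: affine_A_matrix_def)
      then have br: "[j, i, j] \<approx> [i, j, i]" using word_eq_braid[of j i] v "1.prems" by auto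
      have "u \<approx> w @ [i, j]" using eq_word_append_right[OF w(3), of "[j]"] u v by simp
      also have "w @ [i, j] \<approx> w' @ [j, i, j]"
        using eq_word_append_right[OF w'(3), of "[i, j]"] v "1.prems" by simp
      also have "w' @ [j, i, j] \<approx> w' @ [i, j, i]" by (rule eq_word_append_left[OF br w'(1)])
      \<comment> \<open>The word \<open>w'\<close> is at least three letters shorter than
        \<open>u\<close>, so \<open>w' @ [i, j]\<close> is still shorter than
        \<open>u\<close>.\<close>
      finally show ?thesis using w' w u v "1.prems" by (intro bexI[of _ "w' @ [i, j]"]) auto
    next
      case False
      then have "descent v j" using descent_neighbour1[OF nb] by blast
      then obtain w where w: "w \<in> lists {..n}" "length w < length v" "v \<approx> w @ [j]"
        using IH[of v j] u v by auto
      \<comment> \<open>The word \<open>v\<close> is equivalent to one ending in \<open>j\<close>,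
        which the last letter of \<open>u\<close> cancels. The shorter word \<open>w\<close>
        inherits the descent at \<open>i\<close>, so the induction hypothesis applies to it.\<close>
      then have uw: "u \<approx> w" using cancel_square u by blast
      with "1.prems"(3) have "descent w i" by (simp add: descent_word_eq)
      then obtain w' where w': "w' \<in> lists {..n}" "length w' < length w" "w \<approx> w' @ [i]"
        using IH[of w i] w u "1.prems" by auto
      show ?thesis using w' w u word_trans[OF uw w'(3)] by (intro bexI[of _ w']) auto
    qed
  next
    case 3
    define x where "x = int i"
    have pres: "affine_swap N (int j) (x - 1) = x - 1 \<and> affine_swap N (int j) x = x"
    proof -
      have "(x - int j) mod N \<noteq> 0"
        using 3 v "1.prems"(2) mod_eq_dvd_iff[of "int i" N "int j"]
        by (simp add: N_def mod_eq_0_iff_dvd x_def)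
      moreover have c: "(x - int j) mod N \<noteq> 1" "(int j - x) mod N \<noteq> 1"
        using letter_succ_iff 3 v "1.prems" by (auto simp: x_def)
      moreover have "(x - int j) mod N \<noteq> N - 1"
        using c zmod_zminus1_eq_if[of "x - int j" N] N_ge_2 by (auto split: if_splits)
      moreover have "(x - 1 - int j) mod N = (if (x - int j) mod N = 0 then N - 1 else (x - int j) mod N - 1)"
        using mod_pred[OF N_ge_2, of "x - int j"] by (simp add: algebra_simps)
      moreover have "(x - int j) mod N \<noteq> N"
        using pos_mod_bound[of N "x - int j"] N_ge_2 by linarith
      ultimately show ?thesis by (auto intro!: affine_swap_fixed)
    qed
    have "descent v i"
      using "1.prems"(3) pres by (simp add: u descent_def act_append act_single x_def)
    then obtain w where w: "w \<in> lists {..n}" "length w < length v" "v \<approx> w @ [i]"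
      using IH[of v i] u v "1.prems" by auto
    have "M i j = 2 \<or> M i j = 0"
      using 3 by (auto simp: affine_A_matrix_def)
    \<comment> \<open>For \<open>n = 1\<close> two distinct letters are cyclic neighbours, which
      this case excludes; hence the entry \<open>0\<close> cannot occur.\<close>
    moreover have "n \<noteq> 1"
      using 3 v "1.prems"(2) by (auto simp: le_Suc_eq)
    ultimately have "M i j = 2" using 3 by (auto simp: affine_A_matrix_def)
    then have cm: "[i, j] \<approx> [j, i]" using word_eq_commute[of i j] v "1.prems" by auto
    have "u \<approx> w @ [i, j]" using eq_word_append_right[OF w(3), of "[j]"] u v by simp
    also have "w @ [i, j] \<approx> w @ [j, i]" by (rule eq_word_append_left[OF cm w(1)])
    finally show ?thesis using w u v by (intro bexI[of _ "w @ [j]"]) auto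
  qed
qed

text \<open>If \<open>u\<close> ends in \<open>i\<close> without a descent there, the word before
  that letter does descend at \<open>i\<close>. By exchange it is equivalent to a word ending in
  \<open>i\<close>, and the two letters cancel. Consequently only the trivial element of the Coxeter
  group acts as the identity.\<close>

lemma no_descent_imp_trivial:
  assumes "u \<in> lists {..n}" "\<And>i. i \<le> n \<Longrightarrow> \<not> descent u i"
  shows "u \<approx> []"
  using assms
proof (induction u rule: length_induct)
  case (1 u)
  show ?case
  proof (cases u rule: rev_cases)
    case Nil
    then show ?thesis by (auto intro: word_refl)
  next
    case (snoc v i)
    with "1.prems" have v: "v \<in> lists {..n}" "i \<le> n" by auto
    have "act u (int i - 1) = act v (int i)" "act u (int i) = act v (int i - 1)"
      using affine_swap_pred_self[OF N_ge_2] by (simp_all add: snoc act_append act_single affine_swap_self)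
    moreover have "act v (int i) \<noteq> act v (int i - 1)" by (simp add: inj_act)
    ultimately have "descent v i" using "1.prems"(2)[OF v(2)] by (simp add: descent_def)
    from descent_imp_suffix[OF v this]
    obtain w where w: "w \<in> lists {..n}" "length w < length v" "v \<approx> w @ [i]" by blast
    then have uw: "u \<approx> w" using cancel_square snoc by blast
    have "w \<approx> []"
      using "1.IH"[rule_format, of w] w "1.prems"(2) descent_word_eq[OF uw] snoc by auto
    with uw show ?thesis by (rule word_trans)
  qed
qed

text \<open>Letters not congruent to \<open>s\<close> preserve \<open>{..<s}\<close>, so descents at
  them can be split off one by one. When none is left, there is no descent at the residue of
  \<open>s\<close> either, because \<open>s - 1\<close> is sent below \<open>t\<close> and
  \<open>s\<close> is not. What remains is trivial. Thus the stabiliser of an initial segment is a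
  standard parabolic subgroup.\<close>

lemma act_lessThan_imp:
  assumes "u \<in> lists {..n}" "act u ` {..<s} = {..<t}"
  shows "s = t \<and> (\<exists>w. set w \<subseteq> {i. i \<le> n \<and> (s - int i) mod N \<noteq> 0} \<and> u \<approx> w)"
  using assms
proof (induction u rule: length_induct)
  case (1 u)
  show ?case
  proof (cases "\<exists>i\<le>n. (s - int i) mod N \<noteq> 0 \<and> descent u i")
    case True
    then obtain i where i: "i \<le> n" "(s - int i) mod N \<noteq> 0" "descent u i" by blast
    from descent_imp_suffix[OF "1.prems"(1) i(1,3)]
    obtain v where v: "v \<in> lists {..n}" "length v < length u" "u \<approx> v @ [i]" by blast
    then have "act v ` (affine_swap N (int i) ` {..<s}) = {..<t}"
      using "1.prems"(2) act_word_eq[OF v(3)] by (simp add: act_append act_single image_comp)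
    then have "act v ` {..<s} = {..<t}" using affine_swap_lessThan[OF N_ge_2 i(2)] by simp
    then obtain w where w: "s = t" "set w \<subseteq> {i. i \<le> n \<and> (s - int i) mod N \<noteq> 0}" "v \<approx> w"
      using "1.IH" v by blast
    have "u \<approx> w @ [i]"
      using word_trans[OF v(3) eq_word_append_right[OF w(3), of "[i]"]] i by simp
    then show ?thesis using w i by (intro conjI exI[of _ "w @ [i]"]) auto
  next
    case False
    have "\<not> descent u i" if "i \<le> n" for i
    proof (cases "(s - int i) mod N = 0")
      case True
      have "act u (s - 1) \<in> {..<t}" using "1.prems"(2) by auto
      moreover have "act u s \<notin> {..<t}"
        unfolding "1.prems"(2)[symmetric] by (auto simp: inj_act)
      ultimately show ?thesis using descent_cong[OF True] by auto
    qed (use False that in blast)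
    with no_descent_imp_trivial "1.prems"(1) have "u \<approx> []" by blast
    moreover from act_word_eq[OF this] have "s = t" using "1.prems"(2) by simp
    ultimately show ?thesis by (intro conjI exI[of _ "[]"]) auto
  qed
qed

subsection \<open>Periodic sets of integers\<close>

text \<open>A lattice set has a largest element in each of the \<open>N\<close> residue classes; these maxima are the
  coordinates of a point of \<open>\<int>\<^sup>N\<close>, and \<open>shift\<close> adds a multiple of \<open>(1, \<dots>, 1)\<close> to it.\<close>

definition shift_closed :: "int set \<Rightarrow> bool" where
  "shift_closed L \<longleftrightarrow> (\<forall>x\<in>L. \<forall>y\<le>x. N dvd (x - y) \<longrightarrow> y \<in> L)"

definition lattice_set :: "int set \<Rightarrow> bool" where
  "lattice_set L \<longleftrightarrow> (\<exists>a. {..<a} \<subseteq> L) \<and> (\<exists>b. L \<subseteq> {..<b}) \<and> shift_closed L"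

definition shift :: "int \<Rightarrow> int set \<Rightarrow> int set" where
  "shift k L = {x. x - N * k \<in> L}"

lemma shift_closedD: "shift_closed L \<Longrightarrow> x \<in> L \<Longrightarrow> y \<le> x \<Longrightarrow> N dvd (x - y) \<Longrightarrow> y \<in> L"
  unfolding shift_closed_def by blast

lemma affine_swap_diff:
  assumes "N dvd (x - y)"
  shows "affine_swap N i x - x = affine_swap N i y - y"
proof -
  have "N dvd ((x - i) - (y - i))" using assms by simp
  then have "(x - i) mod N = (y - i) mod N" by (simp only: mod_eq_dvd_iff)
  then show ?thesis by (simp add: affine_swap_def)
qed

lemma mem_affine_swap_image: "y \<in> affine_swap N i ` L \<longleftrightarrow> affine_swap N i y \<in> L"
  by (metis image_iff affine_swap_invol[OF N_ge_2])

lemma shift_closed_affine_swap: "shift_closed L \<Longrightarrow> shift_closed (affine_swap N i ` L)"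
  unfolding shift_closed_def[of "affine_swap N i ` L"] mem_affine_swap_image
proof (intro ballI allI impI)
  fix x y assume L: "shift_closed L" and x: "x \<in> affine_swap N i ` L" and y: "y \<le> x" "N dvd (x - y)"
  from affine_swap_diff[OF y(2)] have "affine_swap N i x - affine_swap N i y = x - y" by (simp add: algebra_simps)
  with y have "affine_swap N i y \<le> affine_swap N i x" "N dvd (affine_swap N i x - affine_swap N i y)" by auto
  with L x show "affine_swap N i y \<in> L" using shift_closedD by (metis mem_affine_swap_image)
qed

lemma lattice_set_affine_swap:
  assumes "lattice_set L"
  shows "lattice_set (affine_swap N i ` L)"
proof -
  obtain a b where ab: "{..<a} \<subseteq> L" "L \<subseteq> {..<b}" using assms unfolding lattice_set_def by blast
  have b: "\<bar>affine_swap N i x - x\<bar> \<le> 1" for x by (simp add: affine_swap_def)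
  have "{..<a - 1} \<subseteq> affine_swap N i ` L"
  proof
    fix y assume "y \<in> {..<a - 1}"
    with b[of y] have "affine_swap N i y < a" by auto
    then show "y \<in> affine_swap N i ` L" using ab(1) by (auto simp: mem_affine_swap_image)
  qed
  moreover have "affine_swap N i ` L \<subseteq> {..<b + 1}"
  proof
    fix y assume "y \<in> affine_swap N i ` L"
    then have "affine_swap N i y < b" using ab(2) by (auto simp: mem_affine_swap_image)
    with b[of y] show "y \<in> {..<b + 1}" by auto
  qed
  moreover have "shift_closed (affine_swap N i ` L)"
    using assms shift_closed_affine_swap unfolding lattice_set_def by blast
  ultimately show ?thesis unfolding lattice_set_def by blast
qed

lemma lattice_set_act: "lattice_set L \<Longrightarrow> lattice_set (act u ` L)"
proof (induction u)
  case (Cons i u)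
  then show ?case using lattice_set_affine_swap[of "act u ` L" "int i"] by (simp add: act_Cons image_comp)
qed simp

lemma lattice_set_lessThan: "lattice_set {..<s}"
  unfolding lattice_set_def shift_closed_def by auto

lemma lattice_set_shift: "lattice_set L \<Longrightarrow> lattice_set (shift k L)"
proof -
  assume L: "lattice_set L"
  then obtain a b where ab: "{..<a} \<subseteq> L" "L \<subseteq> {..<b}" unfolding lattice_set_def by blast
  have "{..<a + N * k} \<subseteq> shift k L"
    using ab(1) by (auto simp: shift_def)
  moreover have "shift k L \<subseteq> {..<b + N * k}"
    using ab(2) by (auto simp: shift_def)
  moreover have "shift_closed (shift k L)"
    unfolding shift_closed_def
  proof (intro ballI allI impI)
    fix x y assume "x \<in> shift k L" "y \<le> x" "N dvd (x - y)"
    then show "y \<in> shift k L"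
      using L shift_closedD[of L "x - N * k" "y - N * k"] by (auto simp: shift_def lattice_set_def)
  qed
  ultimately show ?thesis unfolding lattice_set_def by blast
qed

lemma lattice_set_Un: "lattice_set K \<Longrightarrow> lattice_set L \<Longrightarrow> lattice_set (K \<union> L)"
proof -
  assume K: "lattice_set K" and L: "lattice_set L"
  from K obtain a b where "{..<a} \<subseteq> K" "K \<subseteq> {..<b}" unfolding lattice_set_def by blast
  moreover from L obtain a' b' where "{..<a'} \<subseteq> L" "L \<subseteq> {..<b'}" unfolding lattice_set_def by blast
  ultimately have "{..<a} \<subseteq> K \<union> L" "K \<union> L \<subseteq> {..<max b b'}" by auto
  moreover have "shift_closed (K \<union> L)"
    using K L unfolding lattice_set_def shift_closed_def by blast
  ultimately show ?thesis unfolding lattice_set_def by blast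
qed

lemma lattice_set_Int: "lattice_set K \<Longrightarrow> lattice_set L \<Longrightarrow> lattice_set (K \<inter> L)"
proof -
  assume K: "lattice_set K" and L: "lattice_set L"
  from K obtain a b where "{..<a} \<subseteq> K" "K \<subseteq> {..<b}" unfolding lattice_set_def by blast
  moreover from L obtain a' b' where "{..<a'} \<subseteq> L" "L \<subseteq> {..<b'}" unfolding lattice_set_def by blast
  ultimately have "{..<min a a'} \<subseteq> K \<inter> L" "K \<inter> L \<subseteq> {..<b}" by auto
  moreover have "shift_closed (K \<inter> L)"
    using K L unfolding lattice_set_def shift_closed_def by blast
  ultimately show ?thesis unfolding lattice_set_def by blast
qed

lemma shift_shift: "shift j (shift k L) = shift (j + k) L"
  by (simp add: shift_def algebra_simps)

lemma shift_0 [simp]: "shift 0 L = L"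
  by (simp add: shift_def)

lemma shift_mono: "K \<subseteq> L \<Longrightarrow> shift k K \<subseteq> shift k L"
  by (auto simp: shift_def)

lemma shift_Int: "shift k (K \<inter> L) = shift k K \<inter> shift k L"
  and shift_Un: "shift k (K \<union> L) = shift k K \<union> shift k L"
  by (auto simp: shift_def)

lemma shift_le: "lattice_set L \<Longrightarrow> j \<le> k \<Longrightarrow> shift j L \<subseteq> shift k L"
proof
  fix x assume L: "lattice_set L" "j \<le> k" "x \<in> shift j L"
  have "N * j \<le> N * k" using L(2) N_ge_2 by simp
  moreover have "N dvd ((x - N * j) - (x - N * k))" by (auto simp: dvd_diff algebra_simps)
  ultimately show "x \<in> shift k L"
    using L shift_closedD[of L "x - N * j" "x - N * k"] by (auto simp: shift_def lattice_set_def)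
qed

lemma shift_lessThan: "shift k {..<s} = {..<s + N * k}"
  by (auto simp: shift_def)

lemma mem_act_image: "y \<in> act u ` L \<longleftrightarrow> act (rev u) y \<in> L"
  by (metis act_rev act_rev' image_iff)

lemma shift_act: "shift k (act u ` L) = act u ` shift k L"
proof -
  have "act v (x - N * k) = act v x - N * k" for v x
    using act_add_mult[of v x "- k"] by simp
  then show ?thesis by (auto simp: shift_def mem_act_image act_rev)
qed

section \<open>Sorting a lattice set into an initial segment\<close>

lemma downward_closed_eq_lessThan:
  assumes "{..<a} \<subseteq> L" "L \<subseteq> {..<b}" "\<And>k. k + 1 \<in> L \<Longrightarrow> k \<in> L"
  shows "\<exists>c. L = {..<c::int}"
proof -
  have down: "y \<in> L" if "y \<le> x" "x \<in> L" for x y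
    using that by (induction y rule: int_le_induct) (use assms(3) in force)+
  have "\<exists>m. a + int m \<notin> L"
    using assms by (intro exI[of _ "nat (b - a)"]) (cases "b \<ge> a"; force)
  then obtain m where m: "a + int m \<notin> L" "\<And>j. j < m \<Longrightarrow> a + int j \<in> L"
    using exists_least_iff[of "\<lambda>m. a + int m \<notin> L"] by blast
  have "a + int m - 1 \<in> L"
  proof (cases m)
    case 0
    then show ?thesis using assms(1) by auto
  next
    case (Suc j)
    then show ?thesis using m(2)[of j] by simp
  qed
  with m(1) down have "x \<in> L \<longleftrightarrow> x < a + int m" for x
    by (metis linorder_not_less zle_diff1_eq)
  then show ?thesis by blast
qed

text \<open>Bubble sort: a letter exchanging a gap \<open>k \<notin> L\<close> with \<open>k + 1 \<in> L\<close> decreases the sum of the elements.\<close>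

lemma sorting:
  assumes "{..<a} \<subseteq> L" "L \<subseteq> {..<b}" "shift_closed L"
  shows "\<exists>u\<in>lists {..n}. (\<exists>c. act u ` {..<c} = L) \<and> (b \<le> a + N \<longrightarrow> act u ` {..<a} = {..<a})"
  using assms
proof (induction "\<Sum>x\<in>L \<inter> {a..<b}. nat (x - a)" arbitrary: L rule: less_induct)
  case less
  show ?case
  proof (cases "\<forall>k. k + 1 \<in> L \<longrightarrow> k \<in> L")
    case True
    then obtain c where "L = {..<c}" using downward_closed_eq_lessThan less.prems by blast
    then show ?thesis by (intro bexI[of _ "[]"]) auto
  next
    case False
    then obtain k where k: "k + 1 \<in> L" "k \<notin> L" by blast
    define i where "i = nat ((k + 1) mod N)"
    have "0 \<le> (k + 1) mod N" "(k + 1) mod N < N" using N_ge_2 by simp_all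
    then have i: "int i = (k + 1) mod N" "i \<le> n" using N_def unfolding i_def by linarith+
    define S where "S = affine_swap N (k + 1)"
    have Si: "affine_swap N (int i) = S" unfolding S_def by (rule affine_swap_cong) (simp add: i)
    have S: "if N dvd (k + 1 - y) then S y = y - 1 else (N dvd (k - y) \<and> S y = y + 1) \<or> S y = y" for y
    proof -
      have 1: "(y - (k + 1)) mod N = 0 \<longleftrightarrow> N dvd (k + 1 - y)"
        by (metis dvd_diff_commute mod_eq_0_iff_dvd)
      have "N dvd (k - y)" if "(y - (k + 1)) mod N = N - 1"
        using mod_succ[OF N_ge_2, of "y - (k + 1)"] that
        by (simp add: mod_eq_0_iff_dvd dvd_diff_commute)
      with 1 show ?thesis unfolding S_def affine_swap_def by auto
    qed
    \<comment> \<open>As \<open>k\<close> is missing, the members of \<open>L\<close> congruent to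
      \<open>k\<close> lie below \<open>k\<close>, and their successors lie below
      \<open>k + 1\<close>, which is in \<open>L\<close>. So in each pair exchanged by
      \<open>S\<close>, membership of the lower partner forces that of the upper one.\<close>
    have up: "y + 1 \<in> L" if "N dvd (k - y)" "y \<in> L" for y
    proof -
      have "y < k"
        using shift_closedD[OF less.prems(3) that(2), of k] that(1) k(2)
        by (metis dvd_diff_commute linorder_not_less)
      then show ?thesis using shift_closedD[OF less.prems(3) k(1), of "y + 1"] that(1) by simp
    qed
    have up': "y \<in> L" if "N dvd (k + 1 - y)" "y - 1 \<in> L" for y
      using up[of "y - 1"] that by (simp add: algebra_simps)
    define L' where "L' = S ` L"
    have mem: "y \<in> L' \<longleftrightarrow> S y \<in> L" for y by (simp add: L'_def S_def mem_affine_swap_image)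
    have lo: "{..<a} \<subseteq> L'"
    proof
      fix y assume y: "y \<in> {..<a}"
      with less.prems(1) have "y \<in> L" "y - 1 \<in> L" by auto
      with S[of y] up[of y] show "y \<in> L'" by (auto simp: mem split: if_splits)
    qed
    have hi: "L' \<subseteq> {..<b}"
    proof
      fix y assume "y \<in> L'"
      then have "y \<in> L \<or> y + 1 \<in> L" using S[of y] up'[of y] by (auto simp: mem split: if_splits)
      with less.prems(2) show "y \<in> {..<b}" by force
    qed
    have cl: "shift_closed L'" unfolding L'_def S_def by (rule shift_closed_affine_swap) (rule less.prems(3))
    \<comment> \<open>The map \<open>h\<close> sends the window of \<open>L\<close> to a set
      covering the window of \<open>L'\<close>: an element whose lower swap partner is missing drops
      by one, and the others stay. It raises no element and lowers \<open>k + 1\<close>, so the sum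
      drops strictly.\<close>
    define h where "h x = (if N dvd (k + 1 - x) \<and> x - 1 \<notin> L then x - 1 else x)" for x
    have sub: "L' \<inter> {a..<b} \<subseteq> h ` (L \<inter> {a..<b})"
    proof
      fix y assume y: "y \<in> L' \<inter> {a..<b}"
      show "y \<in> h ` (L \<inter> {a..<b})"
      proof (cases "y \<in> L")
        case True
        with y S[of y] have "h y = y" by (auto simp: h_def mem split: if_splits)
        with True y show ?thesis by (metis IntD2 IntI image_eqI)
      next
        case False
        with y S[of y] up'[of y] have *: "N dvd (k - y)" "y + 1 \<in> L" by (auto simp: mem split: if_splits)
        with False have "h (y + 1) = y" by (simp add: h_def)
        moreover have "y + 1 \<in> {a..<b}" using * less.prems(2) y by auto
        ultimately show ?thesis using * by (metis IntI image_eqI)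
      qed
    qed
    have fin: "finite (L \<inter> {a..<b})" by simp
    have "(\<Sum>y\<in>L' \<inter> {a..<b}. nat (y - a)) \<le> (\<Sum>y\<in>h ` (L \<inter> {a..<b}). nat (y - a))"
      using sub by (intro sum_mono2) auto
    also have "\<dots> \<le> (\<Sum>x\<in>L \<inter> {a..<b}. nat (h x - a))"
      using sum_image_le[OF fin, of "\<lambda>y. nat (y - a)" h] by (simp add: comp_def)
    also have "\<dots> < (\<Sum>x\<in>L \<inter> {a..<b}. nat (x - a))"
    proof (rule sum_strict_mono_ex1[OF fin])
      have ka: "a \<le> k" using k(2) less.prems(1) by force
      have "k + 1 \<in> L \<inter> {a..<b}" using k ka less.prems(2) by auto
      moreover have "nat (h (k + 1) - a) < nat (k + 1 - a)" using k ka by (simp add: h_def)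
      ultimately show "\<exists>x\<in>L \<inter> {a..<b}. nat (h x - a) < nat (x - a)" by blast
    qed (auto simp: h_def)
    finally obtain u c where u: "u \<in> lists {..n}" "act u ` {..<c} = L'"
      "b \<le> a + N \<longrightarrow> act u ` {..<a} = {..<a}"
      using less.hyps[of L'] lo hi cl by blast
    have act: "act (i # u) ` A = S ` act u ` A" for A by (simp add: act_Cons Si image_comp)
    have "S ` L' = L" unfolding L'_def S_def by (auto simp: image_comp affine_swap_invol[OF N_ge_2])
    with u(2) have "act (i # u) ` {..<c} = L" by (simp add: act)
    \<comment> \<open>In a window of length at most \<open>N\<close>, the position
      \<open>k + 1\<close> lies strictly between \<open>a\<close> and \<open>a + N\<close>, so the
      letter is not congruent to \<open>a\<close>. This clause later allows the second vertex of an
      edge to be sorted while the first stays in place.\<close>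
    moreover have "act (i # u) ` {..<a} = {..<a}" if "b \<le> a + N"
    proof -
      have "a \<le> k" "k + 1 < b" using k less.prems by force+
      then have "0 < k + 1 - a" "k + 1 - a < N" using that by auto
      then have "\<not> N dvd (k + 1 - a)" using zdvd_not_zless by blast
      then have "(a - (k + 1)) mod N \<noteq> 0" by (simp add: mod_eq_0_iff_dvd dvd_diff_commute)
      then show ?thesis using u(3) that affine_swap_lessThan[OF N_ge_2] by (simp add: act S_def)
    qed
    ultimately show ?thesis using u(1) i(2) by (intro bexI[of _ "i # u"]) auto
  qed
qed

end

section \<open>The Coxeter complex\<close>

context coxeter_matrix
begin

abbreviation word_class :: "'i list \<Rightarrow> 'i list set" where
  "word_class u \<equiv> word_rel I M `` {u}"

lemma word_class_eq_iff:
  assumes "u \<in> lists I" "v \<in> lists I"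
  shows "word_class u = word_class v \<longleftrightarrow> word_eq I M u v"
  using eq_equiv_class_iff[OF equiv_word_rel assms] by (simp add: word_rel_def)

lemma carrier_coxeter_group: "carrier (coxeter_group I M) = word_class ` lists I"
  by (auto simp: coxeter_group_def quotient_def)

text \<open>The generators are their own inverses, so closure under inverses adds nothing to the
  products of generators.\<close>

lemma parabolic_eq:
  assumes "J \<subseteq> I"
  shows "parabolic I M J = word_class ` lists J"
proof
  interpret G: group "coxeter_group I M" by (rule group_coxeter_group)
  have unit: "\<one>\<^bsub>coxeter_group I M\<^esub> = word_class []" by (simp add: coxeter_group_def)
  have JI: "lists J \<subseteq> lists I" using assms by (rule lists_mono)
  have inv_gen: "inv\<^bsub>coxeter_group I M\<^esub> (coxeter_gen I M s) = coxeter_gen I M s" if "s \<in> I" for s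
  proof (rule G.inv_equality)
    show "coxeter_gen I M s \<otimes>\<^bsub>coxeter_group I M\<^esub> coxeter_gen I M s = \<one>\<^bsub>coxeter_group I M\<^esub>"
      using that word_eq_square[OF that]
      by (simp add: coxeter_gen_def coxeter_group_mult_classes unit word_class_eq_iff)
    show "coxeter_gen I M s \<in> carrier (coxeter_group I M)"
      "coxeter_gen I M s \<in> carrier (coxeter_group I M)"
      using that by (auto simp: coxeter_gen_def carrier_coxeter_group)
  qed
  show "parabolic I M J \<subseteq> word_class ` lists J"
  proof
    fix x assume "x \<in> parabolic I M J"
    then show "x \<in> word_class ` lists J"
      unfolding parabolic_def
    proof (induction rule: generate.induct)
      case one
      then show ?case by (use unit in auto)
    next
      case (incl h)
      then show ?case by (auto simp: coxeter_gen_def)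
    next
      case (inv h)
      then obtain s where "s \<in> J" "h = coxeter_gen I M s" by blast
      with inv_gen assms have "inv\<^bsub>coxeter_group I M\<^esub> h = word_class [s]"
        by (auto simp: coxeter_gen_def)
      with \<open>s \<in> J\<close> show ?case by auto
    next
      case (eng g h)
      then obtain u v where "u \<in> lists J" "v \<in> lists J" "g = word_class u" "h = word_class v" by blast
      moreover from this JI have "word_class u \<otimes>\<^bsub>coxeter_group I M\<^esub> word_class v = word_class (u @ v)"
        by (intro coxeter_group_mult_classes) auto
      ultimately show ?case by (intro image_eqI[of _ _ "u @ v"]) auto
    qed
  qed
  show "word_class ` lists J \<subseteq> parabolic I M J"
  proof
    fix x assume "x \<in> word_class ` lists J"
    then obtain u where "u \<in> lists J" "x = word_class u" by blast
    then show "x \<in> parabolic I M J"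
    proof (induction u arbitrary: x)
      case Nil
      then show ?case by (simp add: parabolic_def unit[symmetric] generate.one)
    next
      case (Cons s u)
      then have "word_class u \<in> parabolic I M J" by blast
      moreover have "coxeter_gen I M s \<in> parabolic I M J"
        unfolding parabolic_def using Cons by (intro generate.incl) auto
      ultimately have "coxeter_gen I M s \<otimes>\<^bsub>coxeter_group I M\<^esub> word_class u \<in> parabolic I M J"
        unfolding parabolic_def by (rule generate.eng[rotated])
      moreover have "[s] \<in> lists I" "u \<in> lists I" using Cons JI assms by auto
      ultimately show ?case
        using Cons by (simp add: coxeter_gen_def coxeter_group_mult_classes)
    qed
  qed
qed

section \<open>Vertices as cosets of maximal standard parabolic subgroups\<close>

definition vertex :: "'i list \<Rightarrow> 'i \<Rightarrow> 'i list set set" where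
  "vertex u s = (\<lambda>w. word_class (u @ w)) ` lists (I - {s})"

lemma l_coset_parabolic:
  assumes "u \<in> lists I"
  shows "word_class u <#\<^bsub>coxeter_group I M\<^esub> parabolic I M (I - {s}) = vertex u s"
proof -
  have "word_class u \<otimes>\<^bsub>coxeter_group I M\<^esub> word_class w = word_class (u @ w)"
    if "w \<in> lists (I - {s})" for w
    using that assms lists_mono[of "I - {s}" I] by (intro coxeter_group_mult_classes) auto
  then have "(\<lambda>w. word_class u \<otimes>\<^bsub>coxeter_group I M\<^esub> word_class w) ` lists (I - {s}) = vertex u s"
    unfolding vertex_def by (rule image_cong[OF refl])
  then show ?thesis
    unfolding l_coset_def parabolic_eq[OF Diff_subset] UNION_singleton_eq_range image_image .
qed

lemma mem_coxeter_complex: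
  "\<sigma> \<in> coxeter_complex I M \<longleftrightarrow> (\<exists>u\<in>lists I. \<exists>T\<subseteq>I. T \<noteq> {} \<and> \<sigma> = vertex u ` T)"
proof -
  have eq: "(\<lambda>s. word_class u <#\<^bsub>coxeter_group I M\<^esub> parabolic I M (I - {s})) ` T = vertex u ` T"
    if "u \<in> lists I" for u T
    using l_coset_parabolic[OF that] by (rule image_cong[OF refl])
  show ?thesis
  proof
    assume "\<sigma> \<in> coxeter_complex I M"
    then obtain w T where w: "w \<in> word_class ` lists I" "T \<subseteq> I" "T \<noteq> {}"
      "\<sigma> = (\<lambda>s. w <#\<^bsub>coxeter_group I M\<^esub> parabolic I M (I - {s})) ` T"
      unfolding coxeter_complex_def carrier_coxeter_group mem_Collect_eq by (elim exE conjE)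
    from w(1) obtain u where "u \<in> lists I" "w = word_class u" by (rule imageE)
    with w eq[of u T] show "\<exists>u\<in>lists I. \<exists>T\<subseteq>I. T \<noteq> {} \<and> \<sigma> = vertex u ` T" by metis
  next
    assume "\<exists>u\<in>lists I. \<exists>T\<subseteq>I. T \<noteq> {} \<and> \<sigma> = vertex u ` T"
    then obtain u T where u: "u \<in> lists I" "T \<subseteq> I" "T \<noteq> {}" "\<sigma> = vertex u ` T" by (elim bexE exE conjE)
    show "\<sigma> \<in> coxeter_complex I M"
      unfolding coxeter_complex_def carrier_coxeter_group mem_Collect_eq u(4) eq[OF u(1), symmetric]
      by (intro exI[of _ "word_class u"] exI[of _ T] conjI refl imageI u)
  qed
qed

lemma coxeter_complexI: "u \<in> lists I \<Longrightarrow> T \<subseteq> I \<Longrightarrow> T \<noteq> {} \<Longrightarrow> vertex u ` T \<in> coxeter_complex I M"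
  unfolding mem_coxeter_complex by (intro bexI[of _ u] exI[of _ T] conjI refl)

lemma coxeter_complexE:
  assumes "\<sigma> \<in> coxeter_complex I M"
  obtains u T where "u \<in> lists I" "T \<subseteq> I" "T \<noteq> {}" "\<sigma> = vertex u ` T"
  using assms unfolding mem_coxeter_complex by (elim bexE exE conjE)

lemma vertices_coxeter_complex:
  "v \<in> \<Union>(coxeter_complex I M) \<longleftrightarrow> (\<exists>u\<in>lists I. \<exists>s\<in>I. v = vertex u s)"
proof
  assume "v \<in> \<Union>(coxeter_complex I M)"
  then obtain \<sigma> where "\<sigma> \<in> coxeter_complex I M" "v \<in> \<sigma>" by (rule UnionE)
  from this(1) obtain u T where u: "u \<in> lists I" "T \<subseteq> I" "\<sigma> = vertex u ` T"
    by (rule coxeter_complexE)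
  with \<open>v \<in> \<sigma>\<close> obtain s where "s \<in> T" "v = vertex u s" by blast
  with u show "\<exists>u\<in>lists I. \<exists>s\<in>I. v = vertex u s"
    by (intro bexI[of _ u] bexI[of _ s] subsetD[OF u(2)])
next
  assume "\<exists>u\<in>lists I. \<exists>s\<in>I. v = vertex u s"
  then obtain u s where us: "u \<in> lists I" "s \<in> I" "v = vertex u s" by (elim bexE)
  have "vertex u ` {s} \<in> coxeter_complex I M" using us by (intro coxeter_complexI) simp_all
  then show "v \<in> \<Union>(coxeter_complex I M)" by (rule UnionI) (simp add: us)
qed

lemma edge_coxeter_complex:
  "{a, b} \<in> coxeter_complex I M \<longleftrightarrow> (\<exists>u\<in>lists I. \<exists>s\<in>I. \<exists>t\<in>I. a = vertex u s \<and> b = vertex u t)"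
proof
  assume "{a, b} \<in> coxeter_complex I M"
  then obtain u T where u: "u \<in> lists I" "T \<subseteq> I" "{a, b} = vertex u ` T" by (rule coxeter_complexE)
  have "a \<in> vertex u ` T" "b \<in> vertex u ` T" by (simp_all add: u(3)[symmetric])
  then obtain s t where "s \<in> T" "a = vertex u s" "t \<in> T" "b = vertex u t" by (elim imageE)
  with u(1,2) show "\<exists>u\<in>lists I. \<exists>s\<in>I. \<exists>t\<in>I. a = vertex u s \<and> b = vertex u t"
    by (intro bexI[of _ u] bexI[of _ s] bexI[of _ t] conjI subsetD[OF u(2)])
next
  assume "\<exists>u\<in>lists I. \<exists>s\<in>I. \<exists>t\<in>I. a = vertex u s \<and> b = vertex u t"
  then obtain u s t where u: "u \<in> lists I" "s \<in> I" "t \<in> I" "a = vertex u s" "b = vertex u t"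
    by (elim bexE conjE)
  have "vertex u ` {s, t} \<in> coxeter_complex I M" using u by (intro coxeter_complexI) simp_all
  then show "{a, b} \<in> coxeter_complex I M" by (simp add: u)
qed

lemma mem_vertex:
  assumes "u \<in> lists I" "v \<in> lists I"
  shows "word_class v \<in> vertex u s \<longleftrightarrow> (\<exists>w\<in>lists (I - {s}). word_eq I M v (u @ w))"
proof -
  have "word_class v = word_class (u @ w) \<longleftrightarrow> word_eq I M v (u @ w)" if "w \<in> lists (I - {s})" for w
    using assms that lists_mono[of "I - {s}" I] by (intro word_class_eq_iff) auto
  then show ?thesis unfolding vertex_def image_iff by (intro bex_cong refl)
qed

lemma vertex_subset:
  assumes "u \<in> lists I" "w \<in> lists (I - {s})" "word_eq I M u (v @ w)"
  shows "vertex u s \<subseteq> vertex v s"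
proof
  fix x assume "x \<in> vertex u s"
  then obtain y where y: "y \<in> lists (I - {s})" "x = word_class (u @ y)" by (auto simp: vertex_def)
  then have yI: "y \<in> lists I" using lists_mono[of "I - {s}" I] by auto
  have e: "word_eq I M (u @ y) (v @ w @ y)"
    using word_eq_append[OF assms(3) word_refl[OF yI]] by simp
  then have "x = word_class (v @ w @ y)"
    using word_eq_lists[OF e] y by (simp add: word_class_eq_iff)
  moreover have "w @ y \<in> lists (I - {s})" using assms(2) y(1) by simp
  ultimately show "x \<in> vertex v s" unfolding vertex_def by blast
qed

lemma vertex_eqI:
  assumes "u \<in> lists I" "v \<in> lists I" "w \<in> lists (I - {s})" "word_eq I M u (v @ w)"
  shows "vertex u s = vertex v s"
proof
  show "vertex u s \<subseteq> vertex v s" by (rule vertex_subset[OF assms(1,3,4)])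
  have wI: "w \<in> lists I" using assms(3) lists_mono[of "I - {s}" I] by auto
  then have r: "rev w \<in> lists I" by auto
  have "word_eq I M (v @ (w @ rev w)) (v @ [])"
    using word_eq_append[OF word_refl[OF assms(2)] word_eq_rev[OF r]] by simp
  moreover have "word_eq I M (u @ rev w) (v @ (w @ rev w))"
    using word_eq_append[OF assms(4) word_refl[OF r]] by simp
  ultimately have "word_eq I M (u @ rev w) (v @ [])" by (rule word_trans[rotated])
  from word_sym[OF this] have "word_eq I M v (u @ rev w)" by simp
  moreover have "rev w \<in> lists (I - {s})" using assms(3) by auto
  ultimately show "vertex v s \<subseteq> vertex u s" using assms(2) by (intro vertex_subset)
qed

end

section \<open>The Coxeter complex in terms of lattice sets\<close>

context affine_A
begin

abbreviation "\<Sigma>\<^sub>0 \<equiv> coxeter_complex {..n} M"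

lemma act_append_image: "act (u @ v) ` A = act u ` act v ` A"
  and act_Cons_image: "act (i # u) ` A = affine_swap N (int i) ` act u ` A"
  and act_rev_image: "act (rev u) ` act u ` A = A"
  and act_rev_image': "act u ` act (rev u) ` A = A"
  by (simp_all add: act_append act_Cons image_comp act_rev act_rev')

lemma act_avoiding:
  assumes "w \<in> lists ({..n} - {s})" "s \<le> n"
  shows "act w ` {..<int s} = {..<int s}"
  using assms(1)
proof (induction w)
  case (Cons i w)
  then have i: "i \<le> n" "i \<noteq> s" by auto
  have "(int s - int i) mod N \<noteq> 0"
    using i assms(2) mod_eq_dvd_iff[of "int s" N "int i"] by (simp add: N_def mod_eq_0_iff_dvd)
  then have "affine_swap N (int i) ` {..<int s} = {..<int s}" by (rule affine_swap_lessThan[OF N_ge_2])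
  then show ?case using Cons unfolding act_Cons_image by auto
qed simp

text \<open>An application of \<open>act_lessThan_imp\<close> to \<open>rev v @ u\<close>, where
  \<open>rev v\<close> represents the inverse of \<open>v\<close>.\<close>

lemma act_image_eq_imp:
  assumes "u \<in> lists {..n}" "v \<in> lists {..n}" "act u ` {..<s} = act v ` {..<t}"
  shows "s = t \<and> (\<exists>w. set w \<subseteq> {i. i \<le> n \<and> (s - int i) mod N \<noteq> 0} \<and> u \<approx> v @ w)"
proof -
  have r: "rev v \<in> lists {..n}" using assms(2) by auto
  have "act (rev v @ u) ` {..<s} = {..<t}"
    unfolding act_append_image assms(3) act_rev_image ..
  moreover have "rev v @ u \<in> lists {..n}" using assms(1) r by simp
  ultimately have "s = t \<and> (\<exists>w. set w \<subseteq> {i. i \<le> n \<and> (s - int i) mod N \<noteq> 0} \<and> rev v @ u \<approx> w)"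
    by (rule act_lessThan_imp[rotated])
  then obtain w where "s = t" and w: "set w \<subseteq> {i. i \<le> n \<and> (s - int i) mod N \<noteq> 0}" "rev v @ u \<approx> w"
    by (elim conjE exE)
  have "v @ (rev v @ u) \<approx> v @ w" using eq_word_append_left[OF w(2) assms(2)] .
  moreover have e: "(v @ rev v) @ u \<approx> [] @ u"
    using eq_word_append_right[OF word_eq_rev[OF r] assms(1)] by simp
  ultimately have "u \<approx> v @ w" using word_trans[OF word_sym[OF e], of "v @ w"] by simp
  with w(1) \<open>s = t\<close> show ?thesis by (intro conjI exI[of _ w])
qed

lemma vertex_eq_iff:
  assumes "u \<in> lists {..n}" "v \<in> lists {..n}" "s \<le> n" "t \<le> n"
  shows "vertex u s = vertex v t \<longleftrightarrow> act u ` {..<int s} = act v ` {..<int t}"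
proof
  assume eq: "vertex u s = vertex v t"
  have in_v: "act (u @ x) ` {..<int t} = act v ` {..<int t}" if "x \<in> lists ({..n} - {s})" for x
  proof -
    have "word_class (u @ x) \<in> vertex u s" using that unfolding vertex_def by (rule imageI)
    moreover have "u @ x \<in> lists {..n}" using that assms(1) by auto
    ultimately have "\<exists>w\<in>lists ({..n} - {t}). u @ x \<approx> v @ w"
      unfolding eq using mem_vertex[OF assms(2)] by simp
    then obtain w where w: "w \<in> lists ({..n} - {t})" "u @ x \<approx> v @ w" by (elim bexE)
    have "act (u @ x) ` {..<int t} = act v ` act w ` {..<int t}"
      unfolding act_word_eq[OF w(2)] act_append_image ..
    then show ?thesis unfolding act_avoiding[OF w(1) assms(4)] .
  qed
  \<comment> \<open>If \<open>s\<close> and \<open>t\<close> differed, appending the letter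
    \<open>t\<close> to \<open>u\<close> would stay in the coset, so the swap at \<open>t\<close>
    would preserve \<open>{..<t}\<close>. But it brings \<open>t\<close> into that set.\<close>
  have "s = t"
  proof (rule ccontr)
    assume "s \<noteq> t"
    then have "act (u @ [t]) ` {..<int t} = act u ` {..<int t}"
      using in_v[of "[t]"] in_v[of "[]"] assms(4) by simp
    then have "act u ` affine_swap N (int t) ` {..<int t} = act u ` {..<int t}"
      unfolding act_append_image act_single .
    then have "affine_swap N (int t) ` {..<int t} = {..<int t}"
      unfolding inj_image_eq_iff[OF bij_is_inj[OF bij_act]] .
    moreover have "int t \<in> affine_swap N (int t) ` {..<int t}"
      using affine_swap_self[of N "int t"] by (simp add: mem_affine_swap_image)
    ultimately show False by simp
  qed
  then show "act u ` {..<int s} = act v ` {..<int t}" using in_v[of "[]"] by simp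
next
  assume "act u ` {..<int s} = act v ` {..<int t}"
  from act_image_eq_imp[OF assms(1,2) this]
  obtain w where w: "int s = int t" "set w \<subseteq> {i. i \<le> n \<and> (int s - int i) mod N \<noteq> 0}" "u \<approx> v @ w"
    by (elim conjE exE)
  have "w \<in> lists ({..n} - {s})" using w(2) by (auto simp: in_lists_conv_set)
  then show "vertex u s = vertex v t" using vertex_eqI[OF assms(1,2) _ w(3), of s] w(1) by simp
qed

text \<open>The vertex \<open>u W\<^bsub>I - {s}\<^esub>\<close> is encoded by the image of \<open>{..<s}\<close> under \<open>u\<close>.\<close>

definition vertex_set :: "nat list set set \<Rightarrow> int set" where
  "vertex_set v = (SOME L. \<exists>u\<in>lists {..n}. \<exists>s\<le>n. v = vertex u s \<and> L = act u ` {..<int s})"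

lemma vertex_set_vertex:
  assumes "u \<in> lists {..n}" "s \<le> n"
  shows "vertex_set (vertex u s) = act u ` {..<int s}"
proof -
  have "\<exists>u'\<in>lists {..n}. \<exists>s'\<le>n. vertex u s = vertex u' s' \<and> vertex_set (vertex u s) = act u' ` {..<int s'}"
    unfolding vertex_set_def
    by (rule someI_ex) (intro exI[of _ "act u ` {..<int s}"] bexI[of _ u] exI[of _ s] conjI refl assms)
  then obtain u' s' where u': "u' \<in> lists {..n}" "s' \<le> n" "vertex u s = vertex u' s'"
    "vertex_set (vertex u s) = act u' ` {..<int s'}" by (elim bexE exE conjE)
  then show ?thesis using vertex_eq_iff[OF assms(1) u'(1) assms(2) u'(2)] by simp
qed

text \<open>For lattice sets the inclusions say that each coordinate of \<open>L\<close> minus that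
  of \<open>K\<close> lies between \<open>k\<close> and \<open>k + m\<close>. Hence the maximum
  minus the minimum of the difference is at most \<open>m\<close>; the free choice of
  \<open>k\<close> accounts for multiples of \<open>(1, ..., 1)\<close>.\<close>

definition near :: "nat \<Rightarrow> int set \<Rightarrow> int set \<Rightarrow> bool" where
  "near m K L \<longleftrightarrow> (\<exists>k. shift k K \<subseteq> L \<and> L \<subseteq> shift (k + int m) K)"

lemma lattice_set_vertex:
  assumes "v \<in> \<Union>\<Sigma>\<^sub>0"
  shows "lattice_set (vertex_set v)"
proof -
  from assms obtain u s where "u \<in> lists {..n}" "s \<in> {..n}" "v = vertex u s"
    unfolding vertices_coxeter_complex by (elim bexE)
  then show ?thesis by (simp add: vertex_set_vertex lattice_set_act lattice_set_lessThan)
qed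

lemma lessThan_residue: "\<exists>t\<le>n. \<exists>k. {..<c} = shift k {..<int t}"
proof -
  have "0 \<le> c mod N" "c mod N < N" using N_ge_2 by simp_all
  then have "nat (c mod N) \<le> n" "int (nat (c mod N)) = c mod N" using N_def by linarith+
  moreover have "{..<c} = shift (c div N) {..<c mod N}" by (simp add: shift_lessThan)
  ultimately show ?thesis by metis
qed

text \<open>Sorting writes \<open>L\<close> as the image of some \<open>{..<c}\<close>, and a shift
  reduces \<open>c\<close> modulo \<open>N\<close> to a node of the diagram.\<close>

lemma ex_vertex:
  assumes "lattice_set L"
  shows "\<exists>v\<in>\<Union>\<Sigma>\<^sub>0. \<exists>k. vertex_set v = shift k L"
proof -
  from assms obtain u c where u: "u \<in> lists {..n}" "act u ` {..<c} = L"
    using sorting unfolding lattice_set_def by metis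
  obtain t k where t: "t \<le> n" "{..<c} = shift k {..<int t}" using lessThan_residue by blast
  have "shift (- k) L = act u ` {..<int t}"
    unfolding u(2)[symmetric] t(2) shift_act[symmetric] by (simp add: shift_shift)
  then have "vertex_set (vertex u t) = shift (- k) L" using u t by (simp add: vertex_set_vertex)
  moreover have "vertex u t \<in> \<Union>\<Sigma>\<^sub>0"
    unfolding vertices_coxeter_complex using u(1) t(1) by (intro bexI[of _ u] bexI[of _ t]) simp_all
  ultimately show ?thesis by (intro bexI[of _ "vertex u t"] exI[of _ "- k"])
qed

text \<open>The ends of an edge are two initial segments moved by one and the same word, and such
  segments interleave with their shifts. Conversely, sorting brings two lattice sets related by
  \<open>near 1\<close> into this form.\<close>

lemma adjacency_iff_near:
  assumes "a \<in> \<Union>\<Sigma>\<^sub>0" "b \<in> \<Union>\<Sigma>\<^sub>0"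
  shows "(a, b) \<in> adjacency \<Sigma>\<^sub>0 \<union> Id \<longleftrightarrow> near 1 (vertex_set a) (vertex_set b)"
proof
  have near_self: "near 1 (vertex_set a) (vertex_set a)"
    unfolding near_def using shift_le[OF lattice_set_vertex[OF assms(1)], of 0 1]
    by (intro exI[of _ 0]) simp
  assume "(a, b) \<in> adjacency \<Sigma>\<^sub>0 \<union> Id"
  then consider "a = b" | "{a, b} \<in> \<Sigma>\<^sub>0" by (auto simp: adjacency_def)
  then show "near 1 (vertex_set a) (vertex_set b)"
  proof cases
    case 2
    then obtain u s t where u: "u \<in> lists {..n}" "s \<le> n" "t \<le> n" "a = vertex u s" "b = vertex u t"
      unfolding edge_coxeter_complex by auto
    \<comment> \<open>For \<open>t < s\<close> the segment \<open>{..<t}\<close> lies between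
      \<open>{..<s - N}\<close> and \<open>{..<s}\<close>, which is the shift by
      \<open>- 1\<close>.\<close>
    define k :: int where "k = (if s \<le> t then 0 else - 1)"
    have "{..<int s + N * k} \<subseteq> {..<int t}" "{..<int t} \<subseteq> {..<int s + N * (k + 1)}"
      using u by (auto simp: k_def N_def)
    then show ?thesis
      unfolding near_def using u
      by (intro exI[of _ k]) (auto simp: vertex_set_vertex shift_act shift_lessThan image_mono)
  qed (use near_self in simp)
next
  assume "near 1 (vertex_set a) (vertex_set b)"
  then obtain k where k: "shift k (vertex_set a) \<subseteq> vertex_set b" "vertex_set b \<subseteq> shift (k + 1) (vertex_set a)"
    unfolding near_def by auto
  from assms obtain u s v t where u: "u \<in> lists {..n}" "s \<le> n" "a = vertex u s"
    and v: "v \<in> lists {..n}" "t \<le> n" "b = vertex v t"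
    unfolding vertices_coxeter_complex by auto
  have a: "vertex_set a = act u ` {..<int s}" and b: "vertex_set b = act v ` {..<int t}"
    using u v by (simp_all add: vertex_set_vertex)
  define L where "L = act (rev u) ` vertex_set b"
  have img: "act (rev u) ` shift j (vertex_set a) = {..<int s + N * j}" for j
    by (simp only: a shift_act act_rev_image shift_lessThan)
  \<comment> \<open>After moving \<open>a\<close> to standard position, \<open>L\<close> is confined
    to a window of length exactly \<open>N\<close>. The word \<open>w\<close> that sorts it
    therefore preserves the segment of \<open>a\<close>, and \<open>u @ w\<close> represents both
    vertices at once.\<close>
  have "{..<int s + N * k} \<subseteq> L" "L \<subseteq> {..<int s + N * (k + 1)}"
    unfolding L_def img[symmetric] using k by (auto intro: image_mono)
  moreover have "shift_closed L"
    using lattice_set_act[OF lattice_set_vertex[OF assms(2)]] unfolding L_def lattice_set_def by blast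
  ultimately obtain w c where w: "w \<in> lists {..n}" "act w ` {..<c} = L"
    "act w ` {..<int s + N * k} = {..<int s + N * k}"
    using sorting[of "int s + N * k" L "int s + N * (k + 1)"] by (auto simp: algebra_simps)
  have "shift k (act w ` {..<int s}) = shift k {..<int s}"
    using w(3) by (simp add: shift_act shift_lessThan)
  then have "shift (- k) (shift k (act w ` {..<int s})) = shift (- k) (shift k {..<int s})" by simp
  then have "act w ` {..<int s} = {..<int s}" by (simp add: shift_shift)
  then have 1: "act (u @ w) ` {..<int s} = act u ` {..<int s}" by (simp only: act_append_image)
  have 2: "act (u @ w) ` {..<c} = act v ` {..<int t}"
    by (simp only: act_append_image w(2) L_def act_rev_image' b)
  have uw: "u @ w \<in> lists {..n}" using u w by simp
  have "c = int t" using act_image_eq_imp[OF uw v(1) 2] by (rule conjunct1)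
  with 2 have "b = vertex (u @ w) t" using vertex_eq_iff[OF uw v(1) v(2) v(2)] v(3) by simp
  moreover have "a = vertex (u @ w) s" using 1 vertex_eq_iff[OF uw u(1) u(2) u(2)] u(3) by simp
  ultimately have "{a, b} \<in> \<Sigma>\<^sub>0"
    unfolding edge_coxeter_complex using u(2) v(2) uw
    by (intro bexI[of _ "u @ w"] bexI[of _ s] bexI[of _ t]) simp_all
  then show "(a, b) \<in> adjacency \<Sigma>\<^sub>0 \<union> Id" by (auto simp: adjacency_def)
qed

end

section \<open>Distances in an apartment\<close>

lemma simplicial_iso_adjacency:
  assumes "simplicial_iso f K L" "a \<in> \<Union>K" "b \<in> \<Union>K"
  shows "(f a, f b) \<in> adjacency L \<longleftrightarrow> (a, b) \<in> adjacency K"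
proof -
  have inj: "inj_on f (\<Union>K)" and L: "L = (\<lambda>\<sigma>. f ` \<sigma>) ` K"
    using assms(1) by (auto simp: simplicial_iso_def bij_betw_def)
  have "{f a, f b} \<in> L \<longleftrightarrow> {a, b} \<in> K"
  proof
    assume "{f a, f b} \<in> L"
    then obtain \<sigma> where \<sigma>: "\<sigma> \<in> K" "f ` \<sigma> = f ` {a, b}" unfolding L by auto
    have "\<sigma> \<subseteq> \<Union>K" "{a, b} \<subseteq> \<Union>K" using \<sigma>(1) assms(2,3) by auto
    with \<sigma>(2) have "\<sigma> = {a, b}" using inj_on_image_eq_iff[OF inj] by blast
    with \<sigma>(1) show "{a, b} \<in> K" by simp
  next
    assume "{a, b} \<in> K"
    then have "f ` {a, b} \<in> L" unfolding L by (rule imageI)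
    then show "{f a, f b} \<in> L" by simp
  qed
  moreover have "f a = f b \<longleftrightarrow> a = b" using inj assms(2,3) by (rule inj_on_eq_iff)
  ultimately show ?thesis by (simp add: adjacency_def)
qed

lemma adjacency_vertices: "(a, b) \<in> adjacency K \<Longrightarrow> a \<in> \<Union>K \<and> b \<in> \<Union>K"
  by (auto simp: adjacency_def)

section \<open>Metric constructions with lattice sets\<close>

context affine_A
begin

lemma nearI: "shift k K \<subseteq> L \<Longrightarrow> L \<subseteq> shift (k + int m) K \<Longrightarrow> near m K L"
  unfolding near_def by blast

lemma near_trans:
  assumes "near i K L" "near j L H"
  shows "near (i + j) K H"
proof -
  from assms obtain k l where k: "shift k K \<subseteq> L" "L \<subseteq> shift (k + int i) K"
    and l: "shift l L \<subseteq> H" "H \<subseteq> shift (l + int j) L" unfolding near_def by blast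
  have "shift (l + k) K \<subseteq> H" using shift_mono[OF k(1), of l] l(1) by (auto simp: shift_shift)
  moreover have "H \<subseteq> shift (l + k + int (i + j)) K"
    using shift_mono[OF k(2), of "l + int j"] l(2) by (auto simp: shift_shift algebra_simps)
  ultimately show ?thesis by (rule nearI)
qed

lemma near_shift_right [simp]: "near m K (shift j L) \<longleftrightarrow> near m K L"
proof -
  have "near m K (shift j L)" if "near m K L" for j L
  proof -
    from that obtain k where k: "shift k K \<subseteq> L" "L \<subseteq> shift (k + int m) K" unfolding near_def by blast
    then show ?thesis
      using shift_mono[OF k(1), of j] shift_mono[OF k(2), of j]
      by (intro nearI[of "j + k"]) (simp_all add: shift_shift add.assoc)
  qed
  from this[of L j] this[of "shift j L" "- j"] show ?thesis by (auto simp: shift_shift)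
qed

lemma near_shift_left [simp]: "near m (shift j K) L \<longleftrightarrow> near m K L"
proof -
  have "near m (shift j K) L" if "near m K L" for j K
  proof -
    from that obtain k where k: "shift k K \<subseteq> L" "L \<subseteq> shift (k + int m) K" unfolding near_def by blast
    then show ?thesis by (intro nearI[of "k - j"]) (simp_all add: shift_shift)
  qed
  from this[of K j] this[of "shift j K" "- j"] show ?thesis by (auto simp: shift_shift)
qed

text \<open>Capping the coordinates of \<open>L\<close> at \<open>k + m\<close> above those of
  \<open>K\<close> gives the last but one point of a path from \<open>K\<close> to
  \<open>L\<close>.\<close>

lemma near_split:
  assumes "lattice_set K" "lattice_set L" "near (Suc m) K L"
  shows "\<exists>H. lattice_set H \<and> near m K H \<and> near 1 H L"
proof -
  from assms obtain k where k: "shift k K \<subseteq> L" "L \<subseteq> shift (k + int m + 1) K"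
    unfolding near_def by (auto simp: algebra_simps)
  define H where "H = L \<inter> shift (k + int m) K"
  have "lattice_set H" unfolding H_def using assms by (intro lattice_set_Int lattice_set_shift)
  moreover have "near m K H"
    using k shift_le[OF assms(1), of k "k + int m"] unfolding H_def by (intro nearI[of k]) auto
  moreover have "L \<subseteq> shift 1 H"
    using k(2) shift_le[OF assms(2), of 0 1] unfolding H_def by (auto simp: shift_Int shift_shift add_ac)
  then have "near 1 H L" unfolding H_def by (intro nearI[of 0]) auto
  ultimately show ?thesis by blast
qed

text \<open>The witness lowers the maximal coordinates of \<open>L\<close> relative to \<open>K\<close> by one.\<close>

lemma near_triangle_aux:
  assumes "lattice_set K" "lattice_set L" "lattice_set L'"
    and "K \<subseteq> L" "L \<subseteq> shift (int m + 1) K" "L \<subseteq> L'" "L' \<subseteq> shift 1 L" "L' \<subseteq> shift (int m + 1) K"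
  shows "\<exists>H. lattice_set H \<and> near m K H \<and> near 1 H L \<and> near 1 H L'"
proof -
  define H where "H = L \<inter> shift (int m) K"
  have S: "shift 1 H = shift 1 L \<inter> shift (int m + 1) K"
    unfolding H_def by (simp add: shift_Int shift_shift add.commute)
  have "lattice_set H" unfolding H_def using assms by (intro lattice_set_Int lattice_set_shift)
  moreover have "near m K H"
    using assms(4) shift_le[OF assms(1), of 0 "int m"] unfolding H_def by (intro nearI[of 0]) auto
  moreover have "near 1 H L"
    using assms(5) shift_le[OF assms(2), of 0 1] S unfolding H_def by (intro nearI[of 0]) auto
  moreover have "near 1 H L'"
    using assms(6,7,8) S unfolding H_def by (intro nearI[of 0]) auto
  ultimately show ?thesis by blast
qed

text \<open>Shifts are chosen so that
  \<open>A \<subseteq> L \<subseteq> B \<subseteq> shift 1 L\<close>. The lower bound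
  \<open>i\<close> of \<open>B\<close> relative to \<open>A\<close> is then \<open>0\<close> or
  \<open>1\<close>, since any other value would bring \<open>L\<close> or \<open>B\<close> within
  distance \<open>m\<close> of \<open>A\<close>. For \<open>i = 1\<close> the two points exchange
  roles.\<close>

lemma near_triangle:
  assumes lat: "lattice_set K" "lattice_set L" "lattice_set L'"
    and "near (Suc m) K L" "near (Suc m) K L'" "\<not> near m K L" "\<not> near m K L'" "near 1 L L'"
  shows "\<exists>H. lattice_set H \<and> near m K H \<and> near 1 H L \<and> near 1 H L'"
proof -
  from assms(4) obtain k where k: "shift k K \<subseteq> L" "L \<subseteq> shift (int m + 1) (shift k K)"
    unfolding near_def by (auto simp: algebra_simps shift_shift)
  define A where "A = shift k K"
  from assms(8) obtain j where j: "shift j L \<subseteq> L'" "L' \<subseteq> shift (1 + j) L"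
    unfolding near_def by (auto simp: algebra_simps)
  define B where "B = shift (- j) L'"
  have latAB: "lattice_set A" "lattice_set B" unfolding A_def B_def using lat by (auto intro: lattice_set_shift)
  have LB: "L \<subseteq> B" "B \<subseteq> shift 1 L"
    using shift_mono[OF j(1), of "- j"] shift_mono[OF j(2), of "- j"] by (simp_all add: B_def shift_shift)
  have AL: "A \<subseteq> L" "L \<subseteq> shift (int m + 1) A" using k by (simp_all add: A_def)
  have "near (Suc m) A B" using assms(5) by (simp add: A_def B_def)
  then obtain i where i: "shift i A \<subseteq> B" "B \<subseteq> shift (i + int m + 1) A"
    unfolding near_def by (auto simp: algebra_simps)
  consider "i = 0" | "i = 1" | "i \<ge> 2" | "i \<le> - 1" by linarith
  then have "\<exists>H. lattice_set H \<and> near m A H \<and> near 1 H L \<and> near 1 H B"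
  proof cases
    case 1
    with i LB AL latAB lat show ?thesis by (intro near_triangle_aux) simp_all
  next
    case 2
    have "A \<subseteq> shift (- 1) B" "shift (- 1) B \<subseteq> shift (int m + 1) A"
      using shift_mono[OF i(1), of "- 1"] shift_mono[OF i(2), of "- 1"] 2 by (simp_all add: shift_shift add_ac)
    moreover have "shift (- 1) B \<subseteq> L" "L \<subseteq> shift 1 (shift (- 1) B)"
      using shift_mono[OF LB(2), of "- 1"] LB(1) by (simp_all add: shift_shift)
    ultimately have "\<exists>H. lattice_set H \<and> near m A H \<and> near 1 H (shift (- 1) B) \<and> near 1 H L"
      using AL latAB lat by (intro near_triangle_aux lattice_set_shift) simp_all
    then show ?thesis by auto
  next
    case 3
    have "shift 1 A \<subseteq> shift (i - 1) A" using 3 by (intro shift_le latAB) simp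
    also have "\<dots> \<subseteq> L"
      using shift_mono[OF i(1), of "- 1"] shift_mono[OF LB(2), of "- 1"] by (simp add: shift_shift)
    finally have "near m A L" using AL(2) by (intro nearI[of 1]) (simp_all add: add.commute)
    with assms(6) show ?thesis by (simp add: A_def)
  next
    case 4
    have "B \<subseteq> shift (int m) A"
      using i(2) shift_le[OF latAB(1), of "i + int m + 1" "int m"] 4 by simp
    then have "near m A B" using AL(1) LB(1) by (intro nearI[of 0]) auto
    with assms(7) show ?thesis by (simp add: A_def B_def)
  qed
  then show ?thesis by (simp add: A_def B_def)
qed

text \<open>The witness raises \<open>K\<close> by one in the coordinates in which \<open>L\<close> exceeds it by at least two.\<close>

lemma near_approach:
  assumes lat: "lattice_set K" "lattice_set L"
    and "near (Suc (Suc (Suc m))) K L" "\<not> near (Suc (Suc m)) K L"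
  shows "\<exists>H. lattice_set H \<and> near 1 K H \<and> near (Suc (Suc m)) H L \<and>
    (\<forall>W. lattice_set W \<and> near 1 L W \<and> near (Suc (Suc m)) K W \<longrightarrow> near (Suc m) H W)"
proof -
  from assms(3) obtain k where k: "shift k K \<subseteq> L" "L \<subseteq> shift (int m + 3) (shift k K)"
    unfolding near_def by (auto simp: algebra_simps shift_shift)
  define A where "A = shift k K"
  have latA: "lattice_set A" unfolding A_def using lat by (auto intro: lattice_set_shift)
  have AL: "A \<subseteq> L" "L \<subseteq> shift (int m + 3) A" using k by (simp_all add: A_def)
  define H where "H = A \<union> (shift 1 A \<inter> shift (- 1) L)"
  have "lattice_set H"
    unfolding H_def using lat latA by (intro lattice_set_Un lattice_set_Int lattice_set_shift)
  moreover have "near 1 A H"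
    using shift_le[OF latA, of 0 1] unfolding H_def by (intro nearI[of 0]) auto
  moreover have S: "shift (int m + 2) H = shift (int m + 2) A \<union> (shift (int m + 3) A \<inter> shift (int m + 1) L)"
    unfolding H_def by (simp add: shift_Un shift_Int shift_shift add_ac)
  have "L \<subseteq> shift (int m + 2) H"
    unfolding S using AL(2) shift_le[OF lat(2), of 0 "int m + 1"] by auto
  then have "near (Suc (Suc m)) H L"
    using AL(1) shift_le[OF lat(2), of "- 1" 0] by (intro nearI[of 0]) (auto simp: H_def add.commute)
  moreover have "near (Suc m) H W" if W: "lattice_set W" "near 1 L W" "near (Suc (Suc m)) A W" for W
  proof -
    from W(2) obtain j where j: "shift j L \<subseteq> W" "W \<subseteq> shift (1 + j) L"
      unfolding near_def by (auto simp: algebra_simps)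
    define V where "V = shift (- j) W"
    have LV: "L \<subseteq> V" "V \<subseteq> shift 1 L"
      using shift_mono[OF j(1), of "- j"] shift_mono[OF j(2), of "- j"] by (simp_all add: V_def shift_shift)
    have "near (Suc (Suc m)) A V" using W(3) by (simp add: V_def)
    then obtain i where i: "shift i A \<subseteq> V" "V \<subseteq> shift (i + int m + 2) A"
      unfolding near_def by (auto simp: algebra_simps)
    have no: "\<not> near (Suc (Suc m)) A L" using assms(4) by (simp add: A_def)
    \<comment> \<open>The value \<open>i = 1\<close> is forced: \<open>i \<ge> 2\<close> or
      \<open>i \<le> 0\<close> would bring \<open>L\<close> within distance \<open>m + 2\<close> of
      \<open>A\<close>.\<close>
    have "i < 2"
    proof (rule ccontr)
      assume "\<not> i < 2"
      then have "shift 1 A \<subseteq> shift (i - 1) A" by (intro shift_le latA) simp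
      also have "\<dots> \<subseteq> L"
        using shift_mono[OF i(1), of "- 1"] shift_mono[OF LV(2), of "- 1"] by (simp add: shift_shift)
      finally have "near (Suc (Suc m)) A L" using AL(2) by (intro nearI[of 1]) (simp_all add: add_ac)
      with no show False ..
    qed
    moreover have "i > 0"
    proof (rule ccontr)
      assume "\<not> i > 0"
      then have "L \<subseteq> shift (int m + 2) A"
        using LV(1) i(2) shift_le[OF latA, of "i + int m + 2" "int m + 2"] by auto
      with AL(1) have "near (Suc (Suc m)) A L" by (intro nearI[of 0]) (simp_all add: add_ac)
      with no show False ..
    qed
    ultimately have "i = 1" by simp
    with i have V: "shift 1 A \<subseteq> V" "V \<subseteq> shift (int m + 3) A" by (simp_all add: add_ac)
    \<comment> \<open>Raising \<open>H\<close> by one yields \<open>shift 1 A\<close> together with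
      a part of \<open>L\<close>, and both are contained in \<open>V\<close>. The lower bound thus
      becomes \<open>1\<close> while the upper bound is \<open>m + 2\<close>, which leaves the
      distance \<open>m + 1\<close>.\<close>
    have "shift 1 H \<subseteq> V"
      using V(1) LV(1) by (auto simp: H_def shift_Un shift_Int shift_shift)
    moreover have "V \<subseteq> shift (int m + 2) H"
      unfolding S using V(2) LV(2) shift_le[OF lat(2), of 1 "int m + 1"] by auto
    ultimately have "near (Suc m) H V" by (intro nearI[of 1]) (simp_all add: add_ac)
    then show ?thesis by (simp add: V_def)
  qed
  ultimately show ?thesis by (auto simp: A_def)
qed

text \<open>Coordinates up to shifts on a complex. The three properties pass along simplicial
  isomorphisms, so every apartment has a chart, and they suffice to compute its distances.\<close>

definition chart :: "'a set set \<Rightarrow> ('a \<Rightarrow> int set) \<Rightarrow> bool" where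
  "chart \<Sigma> l \<longleftrightarrow> (\<forall>v\<in>\<Union>\<Sigma>. lattice_set (l v)) \<and>
    (\<forall>L. lattice_set L \<longrightarrow> (\<exists>v\<in>\<Union>\<Sigma>. \<exists>k. l v = shift k L)) \<and>
    (\<forall>a\<in>\<Union>\<Sigma>. \<forall>b\<in>\<Union>\<Sigma>. (a, b) \<in> adjacency \<Sigma> \<union> Id \<longleftrightarrow> near 1 (l a) (l b))"

lemma chart_coxeter_complex: "chart \<Sigma>\<^sub>0 vertex_set"
  unfolding chart_def using lattice_set_vertex ex_vertex adjacency_iff_near by simp

lemma chart_iso:
  assumes "chart K l" "simplicial_iso f K \<Sigma>"
  shows "chart \<Sigma> (l \<circ> inv_into (\<Union>K) f)"
proof -
  define g where "g = inv_into (\<Union>K) f"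
  have f: "bij_betw f (\<Union>K) (\<Union>\<Sigma>)" using assms(2) by (simp add: simplicial_iso_def)
  have g: "g v \<in> \<Union>K" "f (g v) = v" if "v \<in> \<Union>\<Sigma>" for v
    using f that unfolding g_def bij_betw_def by (simp_all add: inv_into_into f_inv_into_f del: Union_iff)
  have gf: "g (f v) = v" if "v \<in> \<Union>K" for v
    using bij_betw_inv_into_left[OF f that] by (simp add: g_def)
  have fV: "f v \<in> \<Union>\<Sigma>" if "v \<in> \<Union>K" for v using f that unfolding bij_betw_def by (metis imageI)
  have "lattice_set (l (g v))" if "v \<in> \<Union>\<Sigma>" for v
    using assms(1) g(1)[OF that] unfolding chart_def by (metis)
  moreover have "\<exists>v\<in>\<Union>\<Sigma>. \<exists>k. l (g v) = shift k L" if "lattice_set L" for L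
  proof -
    obtain w k where "w \<in> \<Union>K" "l w = shift k L" using assms(1) \<open>lattice_set L\<close> unfolding chart_def by metis
    then show ?thesis using gf[of w] fV[of w] by (intro bexI[of _ "f w"]) (auto simp del: Union_iff)
  qed
  moreover have "(a, b) \<in> adjacency \<Sigma> \<union> Id \<longleftrightarrow> near 1 (l (g a)) (l (g b))"
    if ab: "a \<in> \<Union>\<Sigma>" "b \<in> \<Union>\<Sigma>" for a b
  proof -
    have "(a, b) \<in> adjacency \<Sigma> \<longleftrightarrow> (g a, g b) \<in> adjacency K"
      using simplicial_iso_adjacency[OF assms(2) g(1)[OF ab(1)] g(1)[OF ab(2)]] g(2) ab by metis
    moreover have "a = b \<longleftrightarrow> g a = g b" using g(2) ab by metis
    ultimately have "(a, b) \<in> adjacency \<Sigma> \<union> Id \<longleftrightarrow> (g a, g b) \<in> adjacency K \<union> Id" by simp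
    also have "\<dots> \<longleftrightarrow> near 1 (l (g a)) (l (g b))"
      using assms(1) g(1)[OF ab(1)] g(1)[OF ab(2)] unfolding chart_def by metis
    finally show ?thesis .
  qed
  ultimately show ?thesis unfolding chart_def g_def[symmetric] by simp
qed

text \<open>Paths yield \<open>near\<close> by the triangle inequality \<open>near_trans\<close>.
  Conversely, \<open>near_split\<close> supplies the last but one point of a path, and the chart
  realises it by a vertex. The claim starts at distance one because a chart relates
  \<open>near 1\<close> to adjacency or equality.\<close>

lemma reach_iff_near:
  assumes "chart \<Sigma> l" "a \<in> \<Union>\<Sigma>" "b \<in> \<Union>\<Sigma>"
  shows "(a, b) \<in> reach (adjacency \<Sigma>) (Suc m) \<longleftrightarrow> near (Suc m) (l a) (l b)"
  using assms(3)
proof (induction m arbitrary: b)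
  case 0
  have "(a, b) \<in> adjacency \<Sigma> \<union> Id \<longleftrightarrow> near 1 (l a) (l b)"
    using assms(1,2) 0 unfolding chart_def by metis
  then show ?case by simp
next
  case (Suc m)
  have step: "(c, b) \<in> adjacency \<Sigma> \<union> Id \<longleftrightarrow> near 1 (l c) (l b)" if "c \<in> \<Union>\<Sigma>" for c
    using assms(1) that Suc.prems unfolding chart_def by metis
  show ?case
  proof
    assume "(a, b) \<in> reach (adjacency \<Sigma>) (Suc (Suc m))"
    then obtain c where c: "(a, c) \<in> reach (adjacency \<Sigma>) (Suc m)" "(c, b) \<in> adjacency \<Sigma> \<union> Id"
      by (rule relpow_Suc_E)
    then have "c \<in> \<Union>\<Sigma>" using Suc.prems adjacency_vertices by (metis UnE pair_in_Id_conv)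
    with Suc.IH step c have "near (Suc m) (l a) (l c)" "near 1 (l c) (l b)" by metis+
    from near_trans[OF this] show "near (Suc (Suc m)) (l a) (l b)" by simp
  next
    assume "near (Suc (Suc m)) (l a) (l b)"
    moreover have "lattice_set (l a)" "lattice_set (l b)" using assms(1,2) Suc.prems unfolding chart_def by metis+
    ultimately obtain H where H: "lattice_set H" "near (Suc m) (l a) H" "near 1 H (l b)"
      using near_split by metis
    then obtain c k where c: "c \<in> \<Union>\<Sigma>" "l c = shift k H" using assms(1) unfolding chart_def by metis
    with H have "near (Suc m) (l a) (l c)" "near 1 (l c) (l b)" by simp_all
    with Suc.IH[OF c(1)] step[OF c(1)] show "(a, b) \<in> reach (adjacency \<Sigma>) (Suc (Suc m))"
      by (metis relpow_Suc_I)
  qed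
qed

end

lemma reach_simplicial_iso:
  assumes "simplicial_iso f K L" "u \<in> \<Union>K" "v \<in> \<Union>K"
  shows "(f u, f v) \<in> reach (adjacency L) k \<longleftrightarrow> (u, v) \<in> reach (adjacency K) k"
proof
  have f: "bij_betw f (\<Union>K) (\<Union>L)" using assms(1) by (simp add: simplicial_iso_def)
  define g where "g = inv_into (\<Union>K) f"
  have gf: "g (f v) = v" if "v \<in> \<Union>K" for v
    using bij_betw_inv_into_left[OF f that] by (simp add: g_def)
  have g: "g v \<in> \<Union>K" "f (g v) = v" if "v \<in> \<Union>L" for v
    using f that unfolding g_def bij_betw_def by (simp_all add: inv_into_into f_inv_into_f del: Union_iff)
  have adj: "(g a, g b) \<in> adjacency K" if "(a, b) \<in> adjacency L" for a b
  proof -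
    have "a \<in> \<Union>L" "b \<in> \<Union>L" using adjacency_vertices[OF that] by simp_all
    with simplicial_iso_adjacency[OF assms(1), of "g a" "g b"] g that show ?thesis by simp
  qed
  show "(u, v) \<in> reach (adjacency K) k" if "(f u, f v) \<in> reach (adjacency L) k"
    using reach_image[of "adjacency L" g "adjacency K", OF adj that] gf assms(2,3) by simp
  show "(f u, f v) \<in> reach (adjacency L) k" if "(u, v) \<in> reach (adjacency K) k"
    using that
  proof (rule reach_image[rotated])
    fix a b assume "(a, b) \<in> adjacency K"
    with adjacency_vertices[OF this] simplicial_iso_adjacency[OF assms(1)]
    show "(f a, f b) \<in> adjacency L" by metis
  qed
qed

section \<open>Triangle and approach vertices in a complex with a chart\<close>

context affine_A
begin

lemma chart_triangle:
  assumes "chart \<Sigma> l" "x \<in> \<Union>\<Sigma>" "x\<^sub>1 \<in> \<Union>\<Sigma>" "x\<^sub>2 \<in> \<Union>\<Sigma>"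
    and "(x, x\<^sub>1) \<in> reach (adjacency \<Sigma>) (Suc (Suc m))" "(x, x\<^sub>1) \<notin> reach (adjacency \<Sigma>) (Suc m)"
    and "(x, x\<^sub>2) \<in> reach (adjacency \<Sigma>) (Suc (Suc m))" "(x, x\<^sub>2) \<notin> reach (adjacency \<Sigma>) (Suc m)"
    and "(x\<^sub>1, x\<^sub>2) \<in> reach (adjacency \<Sigma>) (Suc 0)"
  shows "\<exists>y\<in>\<Union>\<Sigma>. (x, y) \<in> reach (adjacency \<Sigma>) (Suc m) \<and>
    (y, x\<^sub>1) \<in> reach (adjacency \<Sigma>) (Suc 0) \<and> (y, x\<^sub>2) \<in> reach (adjacency \<Sigma>) (Suc 0)"
proof -
  have lat: "lattice_set (l v)" if "v \<in> \<Union>\<Sigma>" for v using assms(1) that unfolding chart_def by metis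
  note r = reach_iff_near[OF assms(1)]
  obtain H where H: "lattice_set H" "near (Suc m) (l x) H" "near 1 H (l x\<^sub>1)" "near 1 H (l x\<^sub>2)"
    using near_triangle[OF lat[OF assms(2)] lat[OF assms(3)] lat[OF assms(4)], of "Suc m"]
      assms(5-9) by (auto simp only: r assms(2-4) One_nat_def)
  then obtain y k where "y \<in> \<Union>\<Sigma>" "l y = shift k H" using assms(1) unfolding chart_def by metis
  with H assms(2-4) show ?thesis
    by (intro bexI[of _ y]) (simp_all only: r near_shift_left near_shift_right One_nat_def)
qed

lemma chart_approach:
  assumes "chart \<Sigma> l" "x \<in> \<Union>\<Sigma>" "z \<in> \<Union>\<Sigma>"
    and "(x, z) \<in> reach (adjacency \<Sigma>) (Suc (Suc (Suc m)))" "(x, z) \<notin> reach (adjacency \<Sigma>) (Suc (Suc m))"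
  shows "\<exists>c\<in>\<Union>\<Sigma>. (x, c) \<in> reach (adjacency \<Sigma>) (Suc 0) \<and> (c, z) \<in> reach (adjacency \<Sigma>) (Suc (Suc m)) \<and>
    (\<forall>w\<in>\<Union>\<Sigma>. (z, w) \<in> reach (adjacency \<Sigma>) (Suc 0) \<and> (x, w) \<in> reach (adjacency \<Sigma>) (Suc (Suc m)) \<longrightarrow>
      (c, w) \<in> reach (adjacency \<Sigma>) (Suc m))"
proof -
  have lat: "lattice_set (l v)" if "v \<in> \<Union>\<Sigma>" for v using assms(1) that unfolding chart_def by metis
  note r = reach_iff_near[OF assms(1)]
  obtain H where H: "lattice_set H" "near 1 (l x) H" "near (Suc (Suc m)) H (l z)"
    "\<And>W. lattice_set W \<Longrightarrow> near 1 (l z) W \<Longrightarrow> near (Suc (Suc m)) (l x) W \<Longrightarrow> near (Suc m) H W"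
    using near_approach[OF lat[OF assms(2)] lat[OF assms(3)], of m] assms(4,5)
    unfolding r[OF assms(2,3)] by metis
  then obtain c k where c: "c \<in> \<Union>\<Sigma>" "l c = shift k H" using assms(1) unfolding chart_def by metis
  have "(c, w) \<in> reach (adjacency \<Sigma>) (Suc m)"
    if "w \<in> \<Union>\<Sigma>" "(z, w) \<in> reach (adjacency \<Sigma>) (Suc 0)" "(x, w) \<in> reach (adjacency \<Sigma>) (Suc (Suc m))" for w
    using that(2,3) H(4)[OF lat[OF that(1)]]
    unfolding r[OF assms(3) that(1)] r[OF assms(2) that(1)] r[OF c(1) that(1)] c(2) by simp
  moreover have "(x, c) \<in> reach (adjacency \<Sigma>) (Suc 0)" "(c, z) \<in> reach (adjacency \<Sigma>) (Suc (Suc m))"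
    using H(2,3) unfolding r[OF assms(2) c(1)] r[OF c(1) assms(3)] c(2) by simp_all
  ultimately show ?thesis using c(1) by blast
qed

end

section \<open>Buildings\<close>

lemma one_skeleton_vertices:
  assumes "abstract_simplicial_complex K"
  shows "\<Union>(one_skeleton K) = \<Union>K"
proof -
  interpret abstract_simplicial_complex K by fact
  have "{v} \<in> one_skeleton K" if "v \<in> \<sigma>" "\<sigma> \<in> K" for v \<sigma>
    using face[of \<sigma> "{v}"] that by (simp add: one_skeleton_def)
  then show ?thesis by (fastforce simp: one_skeleton_def)
qed

lemma graph_dist_one_skeleton: "graph_dist (one_skeleton K) = graph_dist K"
  by (simp add: graph_dist_def adjacency_one_skeleton fun_eq_iff)

locale affine_A_apartments = affine_A n + apartment_system X \<A> "{..n}" "affine_A_matrix n"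
  for n :: nat and X :: "'a set set" and \<A>
begin

abbreviation dist_le :: "nat \<Rightarrow> ('a \<times> 'a) set" where
  "dist_le k \<equiv> reach (adjacency X) k"

lemma apartment_chart: "\<Sigma> \<in> \<A> \<Longrightarrow> \<exists>l. chart \<Sigma> l"
  using apartment_coxeter chart_iso[OF chart_coxeter_complex] by metis

lemma apartment_vertex:
  assumes "\<Sigma> \<in> \<A>" "v \<in> \<Union>\<Sigma>"
  shows "{v} \<in> \<Sigma>"
proof -
  obtain f where "simplicial_iso f (coxeter_complex {..n} (affine_A_matrix n)) \<Sigma>"
    using apartment_coxeter[OF assms(1)] by (elim exE)
  then have \<Sigma>: "\<Sigma> = (\<lambda>\<sigma>. f ` \<sigma>) ` coxeter_complex {..n} (affine_A_matrix n)"
    by (simp add: simplicial_iso_def)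
  interpret K: abstract_simplicial_complex "coxeter_complex {..n} (affine_A_matrix n)"
    by (intro abstract_simplicial_complex_coxeter_complex) simp
  from assms(2) \<Sigma> obtain \<sigma> u where "\<sigma> \<in> coxeter_complex {..n} (affine_A_matrix n)" "u \<in> \<sigma>" "v = f u"
    by auto
  moreover from this have "{u} \<in> coxeter_complex {..n} (affine_A_matrix n)" using K.face[of \<sigma> "{u}"] by simp
  ultimately show ?thesis unfolding \<Sigma> by (intro image_eqI[of _ _ "{u}"]) simp_all
qed

lemma vertex_simplex: "v \<in> \<Union>X \<Longrightarrow> {v} \<in> X"
  using face by (metis UnionE empty_subsetI insert_not_empty insert_subset)

lemma reach_one_simplex: "(u, v) \<in> reach (adjacency K) (Suc 0) \<Longrightarrow> {u} \<in> K \<Longrightarrow> {u, v} \<in> K"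
  by (auto simp: adjacency_def)

section \<open>Distances in the building and in its apartments\<close>

lemma reach_apartments:
  assumes "\<Sigma> \<in> \<A>" "\<Sigma>' \<in> \<A>" "u \<in> \<Union>\<Sigma>" "v \<in> \<Union>\<Sigma>" "u \<in> \<Union>\<Sigma>'" "v \<in> \<Union>\<Sigma>'"
  shows "(u, v) \<in> reach (adjacency \<Sigma>) k \<longleftrightarrow> (u, v) \<in> reach (adjacency \<Sigma>') k"
proof -
  obtain f where f: "simplicial_iso f \<Sigma> \<Sigma>'" "\<forall>w\<in>{u} \<union> {v}. f w = w"
    using apartment_iso[OF assms(1,2), of "{u}" "{v}"] assms apartment_vertex by metis
  then show ?thesis using reach_simplicial_iso[OF f(1) assms(3,4), of k] by simp
qed

text \<open>Induction on the length, with the apartment left arbitrary. The start \<open>u\<close>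
  and the last edge \<open>{t, v}\<close> share an apartment, and there the induction hypothesis
  handles the path up to \<open>t\<close>. Finally \<open>reach_apartments\<close> transfers the
  bound for \<open>u\<close> and \<open>v\<close> to the given apartment.\<close>

lemma reach_apartment_iff:
  assumes "\<Sigma> \<in> \<A>" "u \<in> \<Union>\<Sigma>" "v \<in> \<Union>\<Sigma>"
  shows "(u, v) \<in> dist_le k \<longleftrightarrow> (u, v) \<in> reach (adjacency \<Sigma>) k"
proof
  have "adjacency \<Sigma> \<subseteq> adjacency X"
    using assms(1) union_apartments by (auto simp: adjacency_def)
  then show "(u, v) \<in> dist_le k" if "(u, v) \<in> reach (adjacency \<Sigma>) k"
    using that reach_subset_mono by blast
  show "(u, v) \<in> reach (adjacency \<Sigma>) k" if "(u, v) \<in> dist_le k"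
    using that assms
  proof (induction k arbitrary: v \<Sigma>)
    case (Suc k)
    from Suc.prems(1) obtain t where t: "(u, t) \<in> dist_le k" "(t, v) \<in> adjacency X \<union> Id"
      by (rule relpow_Suc_E)
    show ?case
    proof (cases "t = v")
      case True
      with Suc t have "(u, v) \<in> reach (adjacency \<Sigma>) k" by metis
      then show ?thesis by (rule reach_mono[rotated]) simp
    next
      case False
      with t have tv: "t \<noteq> v" "{t, v} \<in> X" by (auto simp: adjacency_def)
      have "{u} \<in> X" using Suc.prems union_apartments by (intro vertex_simplex) blast
      with tv obtain \<Sigma>' where \<Sigma>': "\<Sigma>' \<in> \<A>" "{u} \<in> \<Sigma>'" "{t, v} \<in> \<Sigma>'"
        using common_apartment by metis
      then have V: "u \<in> \<Union>\<Sigma>'" "t \<in> \<Union>\<Sigma>'" "v \<in> \<Union>\<Sigma>'" by blast+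
      then have "(u, t) \<in> reach (adjacency \<Sigma>') k" using Suc.IH t \<Sigma>' by metis
      moreover have "(t, v) \<in> adjacency \<Sigma>' \<union> Id" using tv \<Sigma>' by (simp add: adjacency_def)
      ultimately have "(u, v) \<in> reach (adjacency \<Sigma>') (Suc k)" by (rule relpow_Suc_I)
      then show ?thesis unfolding reach_apartments[OF Suc.prems(2) \<Sigma>'(1) Suc.prems(3,4) V(1,3)] .
    qed
  qed simp
qed

lemma dist_le_one_vertex: "(u, v) \<in> dist_le (Suc 0) \<Longrightarrow> u \<in> \<Union>X \<Longrightarrow> v \<in> \<Union>X"
  using vertex_simplex reach_one_simplex by (metis UnionI insertCI)

lemma triangle:
  assumes "x \<in> \<Union>X" "{x\<^sub>1, x\<^sub>2} \<in> X"
    and "(x, x\<^sub>1) \<in> dist_le (Suc (Suc m))" "(x, x\<^sub>1) \<notin> dist_le (Suc m)"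
    and "(x, x\<^sub>2) \<in> dist_le (Suc (Suc m))" "(x, x\<^sub>2) \<notin> dist_le (Suc m)"
  shows "\<exists>y. (x, y) \<in> dist_le (Suc m) \<and> (y, x\<^sub>1) \<in> dist_le (Suc 0) \<and> (y, x\<^sub>2) \<in> dist_le (Suc 0)"
proof -
  obtain \<Sigma> where \<Sigma>: "\<Sigma> \<in> \<A>" "{x} \<in> \<Sigma>" "{x\<^sub>1, x\<^sub>2} \<in> \<Sigma>"
    using common_apartment[OF vertex_simplex[OF assms(1)] assms(2)] by (elim bexE conjE)
  then have V: "x \<in> \<Union>\<Sigma>" "x\<^sub>1 \<in> \<Union>\<Sigma>" "x\<^sub>2 \<in> \<Union>\<Sigma>" by blast+
  obtain l where l: "chart \<Sigma> l" using apartment_chart[OF \<Sigma>(1)] by (elim exE)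
  note r = reach_apartment_iff[OF \<Sigma>(1)]
  have "(x\<^sub>1, x\<^sub>2) \<in> reach (adjacency \<Sigma>) (Suc 0)" using \<Sigma>(3) by (auto simp: adjacency_def)
  with chart_triangle[OF l V] assms(3-6) obtain y where "y \<in> \<Union>\<Sigma>" "(x, y) \<in> reach (adjacency \<Sigma>) (Suc m)"
    "(y, x\<^sub>1) \<in> reach (adjacency \<Sigma>) (Suc 0)" "(y, x\<^sub>2) \<in> reach (adjacency \<Sigma>) (Suc 0)"
    unfolding r[OF V(1,2)] r[OF V(1,3)] by metis
  then show ?thesis using r V by metis
qed

text \<open>The vertex \<open>c\<close> found in one apartment serves every \<open>w\<close>: the condition on \<open>c\<close> is metric, so it is
  carried to an apartment through \<open>{x, c}\<close> and \<open>{z, w}\<close> by an isomorphism fixing \<open>x\<close>, \<open>c\<close> and \<open>z\<close>.\<close>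

lemma approach:
  assumes "x \<in> \<Union>X" "z \<in> \<Union>X"
    and "(x, z) \<in> dist_le (Suc (Suc (Suc m)))" "(x, z) \<notin> dist_le (Suc (Suc m))"
  shows "\<exists>c. (x, c) \<in> dist_le (Suc 0) \<and> (c, z) \<in> dist_le (Suc (Suc m)) \<and>
    (\<forall>w. (z, w) \<in> dist_le (Suc 0) \<and> (x, w) \<in> dist_le (Suc (Suc m)) \<longrightarrow> (c, w) \<in> dist_le (Suc m))"
proof -
  obtain \<Sigma> where \<Sigma>: "\<Sigma> \<in> \<A>" "{x} \<in> \<Sigma>" "{z} \<in> \<Sigma>"
    using common_apartment[OF vertex_simplex[OF assms(1)] vertex_simplex[OF assms(2)]] by (elim bexE conjE)
  then have V: "x \<in> \<Union>\<Sigma>" "z \<in> \<Union>\<Sigma>" by blast+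
  obtain l where l: "chart \<Sigma> l" using apartment_chart[OF \<Sigma>(1)] by (elim exE)
  note r = reach_apartment_iff[OF \<Sigma>(1)]
  from chart_approach[OF l V] assms(3,4) obtain c where c: "c \<in> \<Union>\<Sigma>"
    "(x, c) \<in> reach (adjacency \<Sigma>) (Suc 0)" "(c, z) \<in> reach (adjacency \<Sigma>) (Suc (Suc m))"
    "\<And>w. w \<in> \<Union>\<Sigma> \<Longrightarrow> (z, w) \<in> reach (adjacency \<Sigma>) (Suc 0) \<Longrightarrow> (x, w) \<in> reach (adjacency \<Sigma>) (Suc (Suc m))
      \<Longrightarrow> (c, w) \<in> reach (adjacency \<Sigma>) (Suc m)"
    unfolding r[OF V] by metis
  have xc: "{x, c} \<in> \<Sigma>" using reach_one_simplex[OF c(2) \<Sigma>(2)] .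
  have "(c, w) \<in> dist_le (Suc m)" if w: "(z, w) \<in> dist_le (Suc 0)" "(x, w) \<in> dist_le (Suc (Suc m))" for w
  proof -
    have zw: "{z, w} \<in> X" using reach_one_simplex[OF w(1) vertex_simplex[OF assms(2)]] .
    have "{x, c} \<in> X" using xc \<Sigma>(1) union_apartments by blast
    with zw obtain \<Sigma>' where \<Sigma>': "\<Sigma>' \<in> \<A>" "{x, c} \<in> \<Sigma>'" "{z, w} \<in> \<Sigma>'"
      using common_apartment by metis
    then have V': "x \<in> \<Union>\<Sigma>'" "c \<in> \<Union>\<Sigma>'" "z \<in> \<Union>\<Sigma>'" "w \<in> \<Union>\<Sigma>'" by blast+
    obtain f where f: "simplicial_iso f \<Sigma>' \<Sigma>" "\<forall>v\<in>{x, c} \<union> {z}. f v = v"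
      using apartment_iso[OF \<Sigma>'(1) \<Sigma>(1) \<Sigma>'(2) apartment_vertex[OF \<Sigma>'(1) V'(3)] xc \<Sigma>(3)]
      by (elim exE conjE)
    note r' = reach_apartment_iff[OF \<Sigma>'(1)] and rf = reach_simplicial_iso[OF f(1)]
    have fw: "f w \<in> \<Union>\<Sigma>" using f(1) V'(4) unfolding simplicial_iso_def bij_betw_def by blast
    have "(z, f w) \<in> reach (adjacency \<Sigma>) (Suc 0)"
      using w(1) rf[OF V'(3,4), of "Suc 0"] f(2) unfolding r'[OF V'(3,4)] by simp
    moreover have "(x, f w) \<in> reach (adjacency \<Sigma>) (Suc (Suc m))"
      using w(2) rf[OF V'(1,4), of "Suc (Suc m)"] f(2) unfolding r'[OF V'(1,4)] by simp
    ultimately have "(c, f w) \<in> reach (adjacency \<Sigma>) (Suc m)" by (rule c(4)[OF fw])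
    then show ?thesis using rf[OF V'(2,4), of "Suc m"] f(2) unfolding r'[OF V'(2,4)] by simp
  qed
  then show ?thesis using r c V by metis
qed

text \<open>Each use of \<open>approach\<close> lowers by one the distance bounds to
  \<open>z\<close> and to all the neighbours \<open>w\<close> in question, so a single
  \<open>y\<close> serves them all. At \<open>m = 0\<close> the vertex reached has the required
  property itself.\<close>

lemma gate:
  assumes "x \<in> \<Union>X" "z \<in> \<Union>X"
    and "(x, z) \<in> dist_le (Suc (Suc m))" "(x, z) \<notin> dist_le (Suc m)"
  shows "\<exists>y. (x, y) \<in> dist_le m \<and>
    (\<forall>w. (z, w) \<in> dist_le (Suc 0) \<and> (x, w) \<in> dist_le (Suc m) \<longrightarrow> (y, w) \<in> dist_le (Suc 0))"
  using assms
proof (induction m arbitrary: x)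
  case 0
  show ?case by (intro exI[of _ x]) simp
next
  case (Suc m)
  from approach[OF Suc.prems] obtain c where c: "(x, c) \<in> dist_le (Suc 0)" "(c, z) \<in> dist_le (Suc (Suc m))"
    "\<And>w. (z, w) \<in> dist_le (Suc 0) \<Longrightarrow> (x, w) \<in> dist_le (Suc (Suc m)) \<Longrightarrow> (c, w) \<in> dist_le (Suc m)"
    by metis
  \<comment> \<open>A shorter way from \<open>c\<close> to \<open>z\<close> would bring
    \<open>z\<close> within distance \<open>m + 2\<close> of \<open>x\<close>.\<close>
  have "(c, z) \<notin> dist_le (Suc m)" using reach_trans[OF c(1), of z "Suc m"] Suc.prems(4) by auto
  then obtain y where y: "(c, y) \<in> dist_le m"
    "\<And>w. (z, w) \<in> dist_le (Suc 0) \<Longrightarrow> (c, w) \<in> dist_le (Suc m) \<Longrightarrow> (y, w) \<in> dist_le (Suc 0)"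
    using Suc.IH[OF dist_le_one_vertex[OF c(1) Suc.prems(1)] Suc.prems(2) c(2)] by metis
  have "(x, y) \<in> dist_le (Suc m)" using reach_trans[OF c(1) y(1)] by simp
  with y(2) c(3) show ?case by metis
qed

text \<open>Upper bounds are enough: \<open>w\<close> is farther than \<open>m + 1\<close> from
  \<open>x\<close>, so the triangle inequality turns both bounds on \<open>y\<close> into
  equalities.\<close>

lemma exact_distances:
  assumes "(x, y) \<in> dist_le (Suc m)" "(y, w) \<in> dist_le (Suc 0)" "(x, w) \<notin> dist_le (Suc m)" "w \<in> \<Union>X"
  shows "y \<in> \<Union>X" "graph_dist X y x = enat (Suc m)" "graph_dist X y w = 1"
proof -
  note sym = sym_reach[OF sym_adjacency]
  show "y \<in> \<Union>X" using dist_le_one_vertex sym assms(2,4) by metis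
  have "(y, x) \<notin> dist_le m" using reach_trans[OF sym assms(2), of x m] assms(3) by auto
  then show "graph_dist X y x = enat (Suc m)" using sym[OF assms(1)] by (simp only: graph_dist_eq_Suc_iff) simp
  have "y \<noteq> w" using assms(1,3) by metis
  then show "graph_dist X y w = 1"
    using assms(2) by (simp only: one_enat_def One_nat_def graph_dist_eq_Suc_iff) simp
qed

section \<open>The two conditions of weak modularity\<close>

lemma triangle_condition_building: "triangle_condition (one_skeleton X)"
  unfolding triangle_condition_def graph_dist_one_skeleton adjacency_one_skeleton
    one_skeleton_vertices[OF abstract_simplicial_complex_axioms]
proof (intro ballI allI impI)
  fix x and n :: nat and x\<^sub>1 x\<^sub>2
  assume V: "x \<in> \<Union>X" "x\<^sub>1 \<in> \<Union>X" "x\<^sub>2 \<in> \<Union>X" and n: "2 \<le> n"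
    and H: "(x\<^sub>1, x\<^sub>2) \<in> adjacency X \<and> graph_dist X x x\<^sub>1 = enat n \<and> graph_dist X x x\<^sub>2 = enat n"
  define m where "m = n - 2"
  then have m: "n = Suc (Suc m)" using n by simp
  have d: "(x, x\<^sub>1) \<in> dist_le (Suc (Suc m))" "(x, x\<^sub>1) \<notin> dist_le (Suc m)"
    "(x, x\<^sub>2) \<in> dist_le (Suc (Suc m))" "(x, x\<^sub>2) \<notin> dist_le (Suc m)"
    using H unfolding m graph_dist_eq_Suc_iff by blast+
  have "{x\<^sub>1, x\<^sub>2} \<in> X" using H by (simp add: adjacency_def)
  from triangle[OF V(1) this d] obtain y where y: "(x, y) \<in> dist_le (Suc m)"
    "(y, x\<^sub>1) \<in> dist_le (Suc 0)" "(y, x\<^sub>2) \<in> dist_le (Suc 0)" by (elim exE conjE)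
  from exact_distances[OF y(1,2) d(2) V(2)] exact_distances[OF y(1,3) d(4) V(3)]
  show "\<exists>y\<in>\<Union>X. graph_dist X y x = enat (n - 1) \<and> graph_dist X y x\<^sub>1 = 1 \<and> graph_dist X y x\<^sub>2 = 1"
    unfolding m by (intro bexI[of _ y]) simp_all
qed

lemma quadrangle_condition_building: "quadrangle_condition (one_skeleton X)"
  unfolding quadrangle_condition_def graph_dist_one_skeleton adjacency_one_skeleton
    one_skeleton_vertices[OF abstract_simplicial_complex_axioms]
proof (intro ballI allI impI)
  fix x and n :: nat and x\<^sub>1 x\<^sub>2
  assume V: "x \<in> \<Union>X" "x\<^sub>1 \<in> \<Union>X" "x\<^sub>2 \<in> \<Union>X" and n: "2 \<le> n"
    and H: "graph_dist X x x\<^sub>1 = enat n \<and> graph_dist X x x\<^sub>2 = enat n \<and> graph_dist X x\<^sub>1 x\<^sub>2 = 2 \<and>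
      (\<exists>z\<in>\<Union>X. (x\<^sub>1, z) \<in> adjacency X \<and> (x\<^sub>2, z) \<in> adjacency X \<and> graph_dist X x z = enat (n + 1))"
  from H obtain z where z: "z \<in> \<Union>X" "(x\<^sub>1, z) \<in> adjacency X" "(x\<^sub>2, z) \<in> adjacency X"
    "graph_dist X x z = enat (n + 1)" by blast
  define m where "m = n - 2"
  then have m: "n = Suc (Suc m)" using n by simp
  have d: "(x, x\<^sub>1) \<in> dist_le (Suc (Suc m))" "(x, x\<^sub>1) \<notin> dist_le (Suc m)"
    "(x, x\<^sub>2) \<in> dist_le (Suc (Suc m))" "(x, x\<^sub>2) \<notin> dist_le (Suc m)"
    using H unfolding m graph_dist_eq_Suc_iff by blast+
  have "graph_dist X x z = enat (Suc (Suc (Suc m)))" using z(4) m by simp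
  then have xz: "(x, z) \<in> dist_le (Suc (Suc (Suc m)))" "(x, z) \<notin> dist_le (Suc (Suc m))"
    unfolding graph_dist_eq_Suc_iff by blast+
  have zx: "(z, x\<^sub>1) \<in> dist_le (Suc 0)" "(z, x\<^sub>2) \<in> dist_le (Suc 0)"
    using z(2,3) symD[OF sym_adjacency] by auto
  \<comment> \<open>Since \<open>z\<close> has distance \<open>m + 3\<close> from \<open>x\<close>,
    the lemma \<open>gate\<close> is used with \<open>Suc m\<close>. Both \<open>x\<^sub>1\<close>
    and \<open>x\<^sub>2\<close> are neighbours of \<open>z\<close> at distance \<open>m + 2\<close>
    from \<open>x\<close>, so the same \<open>y\<close> is within distance one of each.\<close>
  from gate[OF V(1) z(1) xz] d zx obtain y where y: "(x, y) \<in> dist_le (Suc m)"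
    "(y, x\<^sub>1) \<in> dist_le (Suc 0)" "(y, x\<^sub>2) \<in> dist_le (Suc 0)" by metis
  from exact_distances[OF y(1,2) d(2) V(2)] exact_distances[OF y(1,3) d(4) V(3)]
  show "\<exists>y\<in>\<Union>X. graph_dist X y x = enat (n - 1) \<and> graph_dist X y x\<^sub>1 = 1 \<and> graph_dist X y x\<^sub>2 = 1"
    unfolding m by (intro bexI[of _ y]) simp_all
qed

end

theorem theorem1:
  fixes X :: "'a set set" and n :: nat
  assumes "n \<ge> 1"
    and "affine_A_building n X"
  shows "weakly_modular (one_skeleton X)"
proof -
  obtain \<A> where \<A>: "apartment_system X \<A> {..n} (affine_A_matrix n)"
    using assms(2) unfolding affine_A_building_def building_of_type_def by (elim exE)
  interpret affine_A_apartments n X \<A>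
    using assms(1) \<A> by (simp add: affine_A_apartments_def affine_A_def)
  show ?thesis
    unfolding weakly_modular_def
    using simplicial_graph_one_skeleton[OF abstract_simplicial_complex_axioms]
      triangle_condition_building quadrangle_condition_building by blast
qed

end
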